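(* Let $R$ be a commutative ring with identity. The following statements are equivalent. (1) $R$ is a $u$-Noetherian ring. (2) $R$ is a $w$-Noetherian ring. (3) $R[X]$ is a $u$-Noetherian ring. (4) $R[X]$ is a $w$-Noetherian ring. (5) $R[X]_{N_u}$ is a Noetherian ring. (6) $R[X]_{N_w}$ is a Noetherian ring. In this case, $u = w$ on $R$, i.e., $I_u = I_w$ for every $R$-submodule $I$ of $T(R)$.
   Context: All rings are commutative with nonzero identity. $T(R)$ is the total quotient ring of $R$; a regular element is a non-zero-divisor; an ideal is regular if it contains a regular element. For an $R$-submodule $I$ of $T(R)$, $I^{-1} = \{x \in T(R) : xI \subseteq R\}$. Let $\mathrm{rGV}(R)$ be the set of finitely generated regular ideals $J$ of $R$ with $J^{-1} = R$. Let $\mathrm{GV}(R)$ be the set of finitely generated ideals $J$ of $R$ such that the homomorphism $\varphi : R \to \mathrm{Hom}_R(J,R)$, $\varphi(r)(a) = ra$, is an isomorphism. For an $R$-submodule $I$ of $T(R)$, $I_u = \{x \in T(R) : xJ \subseteq I \text{ for some } J \in \mathrm{rGV}(R)\}$ and $I_w = \{x \in T(R) : xJ \subseteq I \text{ for some } J \in \mathrm{GV}(R)\}$. For $* \in \{u, w\}$, an integral $*$-ideal is an ideal $I \subseteq R$ with $I_* = I$, and $R$ is $*$-Noetherian if it satisfies the ascending chain condition on integral $*$-ideals. $X$ is an indeterminate over $R$; for $f \in R[X]$, $c(f)$ is the ideal of $R$ generated by the coefficients of $f$; $N_* = \{f \in R[X] : c(f)_* = R\}$ for $* \in \{u,w\}$,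 which is a multiplicative set of regular elements of $R[X]$. *)

theory Defs
  imports
    "HOL-Computational_Algebra.Polynomial"
    "HOL-Library.FuncSet"
    "HOL-Algebra.Ring_Divisibility"
begin

(* The base ring R is a type of class comm_ring_1 (commutative, with 0 different from 1), its
   polynomial ring R[X] is the type of polynomials over it, and a set of elements of R is an ideal
   iff it is a submodule of R. The theory Modules has to be qualified because HOL-Algebra has a
   locale of the same name. *)

definition is_ideal :: "'a::comm_ring_1 set \<Rightarrow> bool" where
  "is_ideal = Modules.module.subspace (*)"

definition ideal_gen :: "'a::comm_ring_1 set \<Rightarrow> 'a set" where
  "ideal_gen = Modules.module.span (*)"

(* Not an interpretation: the rewrite rules of the locale loop with associativity of ( * ). *)
lemma module_ring: "Modules.module ((*) :: 'a::comm_ring_1 \<Rightarrow> 'a \<Rightarrow> 'a)"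
  by unfold_locales (simp_all add: algebra_simps)

lemma is_ideal_iff:
  "is_ideal I \<longleftrightarrow> 0 \<in> I \<and> (\<forall>a\<in>I. \<forall>b\<in>I. a + b \<in> I) \<and> (\<forall>r. \<forall>a\<in>I. r * a \<in> I)"
  by (auto simp: is_ideal_def Modules.module.subspace_def[OF module_ring])

definition fin_gen_ideal :: "'a::comm_ring_1 set \<Rightarrow> bool" where
  "fin_gen_ideal J \<longleftrightarrow> (\<exists>A. finite A \<and> J = ideal_gen A)"

definition regular :: "'a::comm_ring_1 \<Rightarrow> bool" where
  "regular a \<longleftrightarrow> (\<forall>b. a * b = 0 \<longrightarrow> b = 0)"

definition regular_ideal :: "'a::comm_ring_1 set \<Rightarrow> bool" where
  "regular_ideal J \<longleftrightarrow> is_ideal J \<and> (\<exists>a\<in>J. regular a)"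

lemma regular_1 [simp]: "regular 1"
  by (simp add: regular_def)

lemma regular_mult [simp]: "regular a \<Longrightarrow> regular b \<Longrightarrow> regular (a * b)"
  unfolding regular_def by (metis mult.assoc)

lemma regular_cancel: "regular a \<Longrightarrow> a * b = a * c \<Longrightarrow> b = c"
  by (metis regular_def right_diff_distrib right_minus_eq)

lemma regular_nonzero [simp]: "\<not> regular 0"
  unfolding regular_def by (auto intro: exI[of _ 1])


section \<open>The total quotient ring\<close>

definition tq_rel :: "'a::comm_ring_1 \<times> 'a \<Rightarrow> 'a \<times> 'a \<Rightarrow> bool" where
  "tq_rel x y \<longleftrightarrow> regular (snd x) \<and> regular (snd y) \<and> fst x * snd y = fst y * snd x"

lemma part_equivp_tq_rel: "part_equivp (tq_rel :: 'a::comm_ring_1 \<times> 'a \<Rightarrow> _)"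
proof (rule part_equivpI)
  show "\<exists>x :: 'a \<times> 'a. tq_rel x x"
    by (rule exI[of _ "(0, 1)"]) (simp add: tq_rel_def)
  show "symp (tq_rel :: 'a \<times> 'a \<Rightarrow> _)"
    by (auto simp: symp_def tq_rel_def)
  show "transp (tq_rel :: 'a \<times> 'a \<Rightarrow> _)"
  proof (rule transpI)
    fix x y z :: "'a \<times> 'a"
    assume xy: "tq_rel x y" and yz: "tq_rel y z"
    have "snd y * (fst x * snd z) = (fst x * snd y) * snd z" by (simp add: ac_simps)
    also have "\<dots> = (fst y * snd z) * snd x" using xy by (simp add: tq_rel_def ac_simps)
    also have "\<dots> = snd y * (fst z * snd x)" using yz by (simp add: tq_rel_def ac_simps)
    finally show "tq_rel x z"
      using xy yz regular_cancel[of "snd y"] by (auto simp: tq_rel_def)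
  qed
qed

quotient_type (overloaded) 'a tq = "'a::comm_ring_1 \<times> 'a" / partial: tq_rel
  by (rule part_equivp_tq_rel)

instantiation tq :: (comm_ring_1) comm_ring_1
begin

lift_definition zero_tq :: "'a tq" is "(0, 1)"
  by (simp add: tq_rel_def)

lift_definition one_tq :: "'a tq" is "(1, 1)"
  by (simp add: tq_rel_def)

lift_definition plus_tq :: "'a tq \<Rightarrow> 'a tq \<Rightarrow> 'a tq"
  is "\<lambda>x y. (fst x * snd y + fst y * snd x, snd x * snd y)"
proof -
  fix x x' y y' :: "'a \<times> 'a"
  assume x: "tq_rel x x'" and y: "tq_rel y y'"
  have "(fst x * snd y + fst y * snd x) * (snd x' * snd y')
      = (fst x * snd x') * (snd y * snd y') + (fst y * snd y') * (snd x * snd x')"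
    by (simp add: algebra_simps)
  also have "\<dots> = (fst x' * snd x) * (snd y * snd y') + (fst y' * snd y) * (snd x * snd x')"
    using x y by (simp add: tq_rel_def)
  also have "\<dots> = (fst x' * snd y' + fst y' * snd x') * (snd x * snd y)"
    by (simp add: algebra_simps)
  finally show "tq_rel (fst x * snd y + fst y * snd x, snd x * snd y)
      (fst x' * snd y' + fst y' * snd x', snd x' * snd y')"
    using x y by (simp add: tq_rel_def)
qed

lift_definition uminus_tq :: "'a tq \<Rightarrow> 'a tq" is "\<lambda>x. (- fst x, snd x)"
  by (simp add: tq_rel_def)

definition minus_tq :: "'a tq \<Rightarrow> 'a tq \<Rightarrow> 'a tq" where
  "minus_tq x y = x + - y"

lift_definition times_tq :: "'a tq \<Rightarrow> 'a tq \<Rightarrow> 'a tq"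
  is "\<lambda>x y. (fst x * fst y, snd x * snd y)"
proof -
  fix x x' y y' :: "'a \<times> 'a"
  assume x: "tq_rel x x'" and y: "tq_rel y y'"
  have "(fst x * fst y) * (snd x' * snd y') = (fst x * snd x') * (fst y * snd y')"
    by (simp add: ac_simps)
  also have "\<dots> = (fst x' * snd x) * (fst y' * snd y)"
    using x y by (simp add: tq_rel_def)
  also have "\<dots> = (fst x' * fst y') * (snd x * snd y)"
    by (simp add: ac_simps)
  finally show "tq_rel (fst x * fst y, snd x * snd y) (fst x' * fst y', snd x' * snd y')"
    using x y by (simp add: tq_rel_def)
qed

instance
proof
  fix x y z :: "'a tq"
  show "(x + y) + z = x + (y + z)" by transfer (simp add: tq_rel_def algebra_simps)
  show "x + y = y + x" by transfer (simp add: tq_rel_def algebra_simps)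
  show "0 + x = x" by transfer (simp add: tq_rel_def)
  show "- x + x = 0" by transfer (simp add: tq_rel_def)
  show "x - y = x + - y" by (simp add: minus_tq_def)
  show "(x * y) * z = x * (y * z)" by transfer (simp add: tq_rel_def algebra_simps)
  show "x * y = y * x" by transfer (simp add: tq_rel_def algebra_simps)
  show "1 * x = x" by transfer (simp add: tq_rel_def)
  show "(x + y) * z = x * z + y * z" by transfer (simp add: tq_rel_def algebra_simps)
  show "(0::'a tq) \<noteq> 1" by transfer (simp add: tq_rel_def)
qed

end

lift_definition tq_of :: "'a::comm_ring_1 \<Rightarrow> 'a tq" is "\<lambda>a. (a, 1)"
  by (simp add: tq_rel_def)

lemma tq_of_0 [simp]: "tq_of 0 = 0"
  by transfer (simp add: tq_rel_def)

lemma tq_of_1 [simp]: "tq_of 1 = 1"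
  by transfer (simp add: tq_rel_def)

lemma tq_of_add: "tq_of (a + b) = tq_of a + tq_of b"
  by transfer (simp add: tq_rel_def)

lemma tq_of_mult: "tq_of (a * b) = tq_of a * tq_of b"
  by transfer (simp add: tq_rel_def)

lemma tq_of_inject [simp]: "tq_of a = tq_of b \<longleftrightarrow> a = b"
  by transfer (simp add: tq_rel_def)

lift_definition tq_inverse_of :: "'a::comm_ring_1 \<Rightarrow> 'a tq"
  is "\<lambda>s. if regular s then (1, s) else (0, 1)"
  by (simp add: tq_rel_def)

lemma tq_of_times_inverse: "regular s \<Longrightarrow> tq_of s * tq_inverse_of s = 1"
  by transfer (simp add: tq_rel_def)

lemma tq_is_fraction: "\<exists>a s. regular s \<and> x * tq_of s = tq_of a"
  by transfer (auto simp: tq_rel_def)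

definition tq_scale :: "'a::comm_ring_1 \<Rightarrow> 'a tq \<Rightarrow> 'a tq" where
  "tq_scale r x = tq_of r * x"

lemma module_tq: "Modules.module tq_scale"
  by unfold_locales (simp_all add: tq_scale_def algebra_simps tq_of_add tq_of_mult)

definition tq_submodule :: "'a::comm_ring_1 tq set \<Rightarrow> bool" where
  "tq_submodule = Modules.module.subspace tq_scale"

lemma tq_submodule_iff:
  "tq_submodule I \<longleftrightarrow>
     0 \<in> I \<and> (\<forall>x\<in>I. \<forall>y\<in>I. x + y \<in> I) \<and> (\<forall>r. \<forall>x\<in>I. tq_of r * x \<in> I)"
  by (auto simp: tq_submodule_def tq_scale_def Modules.module.subspace_def[OF module_tq])


section \<open>The operations u and w\<close>

(* R is identified with its image under tq_of, which is written range tq_of. *)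

definition tq_inverse :: "'a::comm_ring_1 tq set \<Rightarrow> 'a tq set" where
  "tq_inverse I = {x. \<forall>y\<in>I. x * y \<in> range tq_of}"

definition rGV :: "'a::comm_ring_1 set set" where
  "rGV = {J. fin_gen_ideal J \<and> regular_ideal J \<and> tq_inverse (tq_of ` J) = range tq_of}"

(* R-linear maps from the ideal J to R, as functions that are undefined outside J. *)
definition Hom_to_ring :: "'a::comm_ring_1 set \<Rightarrow> ('a \<Rightarrow> 'a) set" where
  "Hom_to_ring J = {f \<in> J \<rightarrow>\<^sub>E UNIV.
     (\<forall>a\<in>J. \<forall>b\<in>J. f (a + b) = f a + f b) \<and> (\<forall>r. \<forall>a\<in>J. f (r * a) = r * f a)}"

(* The map phi sending r to multiplication by r is linear, so it is an isomorphism iff it is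
   bijective. *)
definition GV :: "'a::comm_ring_1 set set" where
  "GV = {J. fin_gen_ideal J \<and> bij_betw (\<lambda>r. \<lambda>a\<in>J. r * a) UNIV (Hom_to_ring J)}"

definition u_closure :: "'a::comm_ring_1 tq set \<Rightarrow> 'a tq set" where
  "u_closure I = {x. \<exists>J\<in>rGV. \<forall>j\<in>J. x * tq_of j \<in> I}"

definition w_closure :: "'a::comm_ring_1 tq set \<Rightarrow> 'a tq set" where
  "w_closure I = {x. \<exists>J\<in>GV. \<forall>j\<in>J. x * tq_of j \<in> I}"

definition integral_star_ideal ::
    "('a::comm_ring_1 tq set \<Rightarrow> 'a tq set) \<Rightarrow> 'a set \<Rightarrow> bool" where
  "integral_star_ideal star I \<longleftrightarrow> is_ideal I \<and> star (tq_of ` I) = tq_of ` I"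

definition star_noetherian :: "('a::comm_ring_1 tq set \<Rightarrow> 'a tq set) \<Rightarrow> bool" where
  "star_noetherian star \<longleftrightarrow>
     (\<forall>I :: nat \<Rightarrow> 'a set. (\<forall>n. integral_star_ideal star (I n)) \<and> (\<forall>n. I n \<subseteq> I (Suc n))
        \<longrightarrow> (\<exists>n. \<forall>m\<ge>n. I m = I n))"

definition u_noetherian :: "'a::comm_ring_1 itself \<Rightarrow> bool" where
  "u_noetherian _ \<longleftrightarrow> star_noetherian (u_closure :: 'a tq set \<Rightarrow> 'a tq set)"

definition w_noetherian :: "'a::comm_ring_1 itself \<Rightarrow> bool" where
  "w_noetherian _ \<longleftrightarrow> star_noetherian (w_closure :: 'a tq set \<Rightarrow> 'a tq set)"

(* The library constant content is a gcd of the coefficients and needs a gcd domain. *)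
definition content_ideal :: "'a::comm_ring_1 poly \<Rightarrow> 'a set" where
  "content_ideal f = ideal_gen (range (poly.coeff f))"

definition N_star :: "('a::comm_ring_1 tq set \<Rightarrow> 'a tq set) \<Rightarrow> 'a poly set" where
  "N_star star = {f. star (tq_of ` content_ideal f) = range tq_of}"

definition N_u :: "'a::comm_ring_1 poly set" where
  "N_u = N_star u_closure"

definition N_w :: "'a::comm_ring_1 poly set" where
  "N_w = N_star w_closure"


section \<open>Localization\<close>

(* The localization at S is a record of HOL-Algebra, since S need not be determined by a type. *)

definition loc_rel :: "'a::comm_ring_1 set \<Rightarrow> (('a \<times> 'a) \<times> ('a \<times> 'a)) set" where
  "loc_rel S = {((a, s), (b, t)). s \<in> S \<and> t \<in> S \<and> (\<exists>v\<in>S. v * (a * t - b * s) = 0)}"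

definition loc_frac :: "'a::comm_ring_1 set \<Rightarrow> 'a \<Rightarrow> 'a \<Rightarrow> ('a \<times> 'a) set" where
  "loc_frac S a s = loc_rel S `` {(a, s)}"

(* The unions run over all representatives; they are single classes by loc_mult and loc_add. *)
definition localization :: "'a::comm_ring_1 set \<Rightarrow> ('a \<times> 'a) set ring" where
  "localization S =
     \<lparr>carrier = (UNIV \<times> S) // loc_rel S,
      mult = (\<lambda>x y. \<Union>(a, s)\<in>x. \<Union>(b, t)\<in>y. loc_frac S (a * b) (s * t)),
      one = loc_frac S 1 1,
      zero = loc_frac S 0 1,
      add = (\<lambda>x y. \<Union>(a, s)\<in>x. \<Union>(b, t)\<in>y. loc_frac S (a * t + b * s) (s * t))\<rparr>"

context
  fixes S :: "'a::comm_ring_1 set"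
  assumes one_S: "1 \<in> S" and mult_S: "\<And>s t. s \<in> S \<Longrightarrow> t \<in> S \<Longrightarrow> s * t \<in> S"
begin

lemma equiv_loc_rel: "equiv (UNIV \<times> S) (loc_rel S)"
proof (rule equivI)
  show "loc_rel S \<subseteq> (UNIV \<times> S) \<times> (UNIV \<times> S)"
    by (auto simp: loc_rel_def)
  show "refl_on (UNIV \<times> S) (loc_rel S)"
    using one_S by (auto simp: loc_rel_def refl_on_def)
  show "sym (loc_rel S)"
  proof (rule symI)
    fix x y assume "(x, y) \<in> loc_rel S"
    then obtain a s b t v where *: "x = (a, s)" "y = (b, t)" "s \<in> S" "t \<in> S" "v \<in> S"
      "v * (a * t - b * s) = 0" by (auto simp: loc_rel_def)
    have "v * (b * s - a * t) = - (v * (a * t - b * s))" by (simp add: algebra_simps)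
    then show "(y, x) \<in> loc_rel S" using * by (auto simp: loc_rel_def)
  qed
  show "trans (loc_rel S)"
  proof (rule transI)
    fix x y z assume "(x, y) \<in> loc_rel S" "(y, z) \<in> loc_rel S"
    then obtain a s b t c r v w where *: "x = (a, s)" "y = (b, t)" "z = (c, r)"
      "s \<in> S" "t \<in> S" "r \<in> S" "v \<in> S" "w \<in> S"
      "v * (a * t - b * s) = 0" "w * (b * r - c * t) = 0" by (auto simp: loc_rel_def)
    have "(v * w * t) * (a * r - c * s)
        = w * r * (v * (a * t - b * s)) + v * s * (w * (b * r - c * t))"
      by (simp add: algebra_simps)
    also have "\<dots> = 0" using * by simp
    finally show "(x, z) \<in> loc_rel S"
      using * mult_S by (auto simp: loc_rel_def intro!: bexI[of _ "v * w * t"])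
  qed
qed

lemma loc_frac_eq_iff:
  "s \<in> S \<Longrightarrow> t \<in> S \<Longrightarrow>
     loc_frac S a s = loc_frac S b t \<longleftrightarrow> (\<exists>v\<in>S. v * (a * t - b * s) = 0)"
  unfolding loc_frac_def using eq_equiv_class_iff[OF equiv_loc_rel, of "(a, s)" "(b, t)"]
  by (auto simp: loc_rel_def)

lemma loc_frac_closed: "s \<in> S \<Longrightarrow> loc_frac S a s \<in> carrier (localization S)"
  by (simp add: localization_def loc_frac_def quotientI)

lemma loc_cases:
  assumes "x \<in> carrier (localization S)"
  obtains a s where "s \<in> S" "x = loc_frac S a s"
  using assms by (auto simp: localization_def loc_frac_def elim!: quotientE)

lemma loc_mult:
  assumes "s \<in> S" "t \<in> S"
  shows "loc_frac S a s \<otimes>\<^bsub>localization S\<^esub> loc_frac S b t = loc_frac S (a * b) (s * t)"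
proof -
  have "loc_frac S (a * b) (s * t) = loc_frac S (a' * b') (s' * t')"
    if "(a', s') \<in> loc_frac S a s" "(b', t') \<in> loc_frac S b t" for a' s' b' t'
  proof -
    obtain v w where *: "s' \<in> S" "t' \<in> S" "v \<in> S" "w \<in> S"
      "v * (a * s' - a' * s) = 0" "w * (b * t' - b' * t) = 0"
      using \<open>(a', s') \<in> _\<close> \<open>(b', t') \<in> _\<close> by (auto simp: loc_frac_def loc_rel_def)
    have "(v * w) * ((a * b) * (s' * t') - (a' * b') * (s * t))
        = w * b * t' * (v * (a * s' - a' * s)) + v * a' * s * (w * (b * t' - b' * t))"
      by (simp add: algebra_simps)
    then have "(v * w) * ((a * b) * (s' * t') - (a' * b') * (s * t)) = 0" using * by simp
    then show ?thesis using * assms mult_S by (subst loc_frac_eq_iff) blast+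
  qed
  note const = this[symmetric]
  have mem: "(a, s) \<in> loc_frac S a s" "(b, t) \<in> loc_frac S b t"
    using assms one_S by (auto simp: loc_frac_def loc_rel_def)
  show ?thesis
    unfolding localization_def ring.simps monoid.simps
    by (rule UN_constant_eq[OF mem(1)], clarify, rule UN_constant_eq[OF mem(2)], clarify,
        rule const)
qed

lemma loc_add:
  assumes "s \<in> S" "t \<in> S"
  shows "loc_frac S a s \<oplus>\<^bsub>localization S\<^esub> loc_frac S b t = loc_frac S (a * t + b * s) (s * t)"
proof -
  have "loc_frac S (a * t + b * s) (s * t) = loc_frac S (a' * t' + b' * s') (s' * t')"
    if "(a', s') \<in> loc_frac S a s" "(b', t') \<in> loc_frac S b t" for a' s' b' t'
  proof -
    obtain v w where *: "s' \<in> S" "t' \<in> S" "v \<in> S" "w \<in> S"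
      "v * (a * s' - a' * s) = 0" "w * (b * t' - b' * t) = 0"
      using \<open>(a', s') \<in> _\<close> \<open>(b', t') \<in> _\<close> by (auto simp: loc_frac_def loc_rel_def)
    have "(v * w) * ((a * t + b * s) * (s' * t') - (a' * t' + b' * s') * (s * t))
        = w * t * t' * (v * (a * s' - a' * s)) + v * s * s' * (w * (b * t' - b' * t))"
      by (simp add: algebra_simps)
    then have "(v * w) * ((a * t + b * s) * (s' * t') - (a' * t' + b' * s') * (s * t)) = 0"
      using * by simp
    then show ?thesis using * assms mult_S by (subst loc_frac_eq_iff) blast+
  qed
  note const = this[symmetric]
  have mem: "(a, s) \<in> loc_frac S a s" "(b, t) \<in> loc_frac S b t"
    using assms one_S by (auto simp: loc_frac_def loc_rel_def)
  show ?thesis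
    unfolding localization_def ring.simps monoid.simps
    by (rule UN_constant_eq[OF mem(1)], clarify, rule UN_constant_eq[OF mem(2)], clarify,
        rule const)
qed

lemma cring_localization: "cring (localization S)"
proof -
  let ?L = "localization S"
  have one: "\<one>\<^bsub>?L\<^esub> = loc_frac S 1 1" and zero: "\<zero>\<^bsub>?L\<^esub> = loc_frac S 0 1"
    by (simp_all add: localization_def)
  have eqI: "loc_frac S a s = loc_frac S b t" if "s \<in> S" "t \<in> S" "a * t = b * s" for a b s t
    using that one_S by (subst loc_frac_eq_iff) auto
  note ops = one zero loc_mult loc_add one_S mult_S loc_frac_closed
  show ?thesis
  proof (intro cringI abelian_groupI comm_monoidI)
    fix x y assume "x \<in> carrier ?L" "y \<in> carrier ?L"
    then obtain a s b t where
      x: "s \<in> S" "x = loc_frac S a s" and y: "t \<in> S" "y = loc_frac S b t"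
      using loc_cases by metis
    show "x \<oplus>\<^bsub>?L\<^esub> y \<in> carrier ?L" "x \<otimes>\<^bsub>?L\<^esub> y \<in> carrier ?L"
      using x y by (simp_all add: ops)
    show "x \<oplus>\<^bsub>?L\<^esub> y = y \<oplus>\<^bsub>?L\<^esub> x" "x \<otimes>\<^bsub>?L\<^esub> y = y \<otimes>\<^bsub>?L\<^esub> x"
      using x y by (simp_all add: ops ac_simps)
    fix z assume "z \<in> carrier ?L"
    then obtain c r where z: "r \<in> S" "z = loc_frac S c r" using loc_cases by metis
    show "(x \<oplus>\<^bsub>?L\<^esub> y) \<oplus>\<^bsub>?L\<^esub> z = x \<oplus>\<^bsub>?L\<^esub> (y \<oplus>\<^bsub>?L\<^esub> z)"
      "(x \<otimes>\<^bsub>?L\<^esub> y) \<otimes>\<^bsub>?L\<^esub> z = x \<otimes>\<^bsub>?L\<^esub> (y \<otimes>\<^bsub>?L\<^esub> z)"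
      using x y z by (simp_all add: ops algebra_simps)
    show "(x \<oplus>\<^bsub>?L\<^esub> y) \<otimes>\<^bsub>?L\<^esub> z = x \<otimes>\<^bsub>?L\<^esub> z \<oplus>\<^bsub>?L\<^esub> y \<otimes>\<^bsub>?L\<^esub> z"
      unfolding x y z using x y z
      by (simp add: ops, intro eqI) (simp_all add: ops algebra_simps)
  next
    fix x assume "x \<in> carrier ?L"
    then obtain a s where x: "s \<in> S" "x = loc_frac S a s" by (rule loc_cases)
    show "\<zero>\<^bsub>?L\<^esub> \<oplus>\<^bsub>?L\<^esub> x = x" "\<one>\<^bsub>?L\<^esub> \<otimes>\<^bsub>?L\<^esub> x = x"
      using x by (simp_all add: ops)
    have "loc_frac S (- a) s \<oplus>\<^bsub>?L\<^esub> x = loc_frac S 0 (s * s)"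
      using x by (simp add: ops)
    also have "\<dots> = \<zero>\<^bsub>?L\<^esub>"
      unfolding zero using x one_S mult_S by (intro eqI) simp_all
    finally show "\<exists>y\<in>carrier ?L. y \<oplus>\<^bsub>?L\<^esub> x = \<zero>\<^bsub>?L\<^esub>"
      using x loc_frac_closed by blast
  qed (simp_all add: ops)
qed

end

end

theory Submission
  imports Defs
begin

text \<open>For both operations the ideals fixed by the closure can be described inside R, so the two
  cases are instances of one argument about a multiplicative system G of Glaz-Vasconcelos ideals
  (rGV is the set of regular members of GV). If R is w-Noetherian, then annihilators satisfy the
  ascending chain condition, because they are w-ideals. Hence the zero divisors form a finite union
  of primes of the form ann(a), and prime avoidance shows that every member of GV is regular. So
  GV = rGV and u = w. The argument of Hilbert's basis theorem, with leading coefficients taken up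
  to closure, produces for every ideal A of R[X] a finite subset such that
  every f in A satisfies Jf \<subseteq> B for some J in G, where B is the ideal generated by the subset. A
  polynomial with content J then moves f into B in the localization, and the extension of J to R[X]
  is in GV(R[X]). For the converse directions one extends a chain of ideals from R and contracts it
  again, using that the coefficients of the members of an ideal in GV(R[X]) generate an ideal in
  GV(R).\<close>

section \<open>Ideals\<close>

lemma is_idealI:
  assumes "0 \<in> I" "\<And>a b. a \<in> I \<Longrightarrow> b \<in> I \<Longrightarrow> a + b \<in> I" "\<And>r a. a \<in> I \<Longrightarrow> r * a \<in> I"
  shows "is_ideal I"
  using assms by (simp add: is_ideal_iff)

lemma is_idealD:
  assumes "is_ideal I"
  shows "0 \<in> I" "\<And>a b. a \<in> I \<Longrightarrow> b \<in> I \<Longrightarrow> a + b \<in> I" "\<And>r a. a \<in> I \<Longrightarrow> r * a \<in> I"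
    "\<And>r a. a \<in> I \<Longrightarrow> a * r \<in> I"
  using assms by (auto simp: is_ideal_iff mult.commute)

lemma is_ideal_uminus: "is_ideal I \<Longrightarrow> a \<in> I \<Longrightarrow> - a \<in> I"
  using is_idealD(3)[of I a "- 1"] by simp

lemma is_ideal_diff: "is_ideal I \<Longrightarrow> a \<in> I \<Longrightarrow> b \<in> I \<Longrightarrow> a - b \<in> I"
  using is_idealD(2)[of I a "- b"] is_ideal_uminus[of I b] by simp

lemma is_ideal_sum: "is_ideal I \<Longrightarrow> (\<And>x. x \<in> A \<Longrightarrow> f x \<in> I) \<Longrightarrow> sum f A \<in> I"
  by (induction A rule: infinite_finite_induct) (auto simp: is_idealD)

lemma is_ideal_UNIV [simp]: "is_ideal UNIV"
  by (simp add: is_ideal_iff)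

lemma is_ideal_gen [simp]: "is_ideal (ideal_gen A)"
  by (simp add: is_ideal_def ideal_gen_def Modules.module.subspace_span[OF module_ring])

lemma ideal_gen_superset: "A \<subseteq> ideal_gen A"
  by (simp add: ideal_gen_def Modules.module.span_superset[OF module_ring])

lemma ideal_gen_least: "A \<subseteq> I \<Longrightarrow> is_ideal I \<Longrightarrow> ideal_gen A \<subseteq> I"
  by (simp add: is_ideal_def ideal_gen_def Modules.module.span_minimal[OF module_ring])

lemma ideal_gen_base: "a \<in> A \<Longrightarrow> a \<in> ideal_gen A"
  using ideal_gen_superset by blast

lemma ideal_gen_mono: "A \<subseteq> ideal_gen B \<Longrightarrow> ideal_gen A \<subseteq> ideal_gen B"
  by (simp add: ideal_gen_least)

lemma fin_gen_idealD: "fin_gen_ideal J \<Longrightarrow> is_ideal J"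
  by (auto simp: fin_gen_ideal_def)

lemma fin_gen_ideal_UNIV [simp]: "fin_gen_ideal UNIV"
proof -
  have "x \<in> ideal_gen {1}" for x :: 'a
    using is_idealD(3)[of "ideal_gen {1}" 1 x] by (simp add: ideal_gen_base)
  then have "UNIV = ideal_gen {1::'a}" by blast
  then show ?thesis unfolding fin_gen_ideal_def by blast
qed

definition ideal_prod :: "'a::comm_ring_1 set \<Rightarrow> 'a set \<Rightarrow> 'a set" where
  "ideal_prod J K = ideal_gen {a * b |a b. a \<in> J \<and> b \<in> K}"

lemma is_ideal_prod [simp]: "is_ideal (ideal_prod J K)"
  by (simp add: ideal_prod_def)

lemma ideal_prod_memI: "a \<in> J \<Longrightarrow> b \<in> K \<Longrightarrow> a * b \<in> ideal_prod J K"
  unfolding ideal_prod_def by (rule ideal_gen_base) blast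

lemma ideal_prod_least:
  "is_ideal I \<Longrightarrow> (\<And>a b. a \<in> J \<Longrightarrow> b \<in> K \<Longrightarrow> a * b \<in> I) \<Longrightarrow> ideal_prod J K \<subseteq> I"
  unfolding ideal_prod_def by (rule ideal_gen_least) auto

lemma ideal_prod_subset:
  assumes "is_ideal J" "is_ideal K"
  shows "ideal_prod J K \<subseteq> J" "ideal_prod J K \<subseteq> K"
  by (rule ideal_prod_least; use assms in \<open>auto intro: is_idealD\<close>)+

text \<open>The ideal quotient (I : a). It turns aJ \<subseteq> I into an inclusion of ideals that
  can be checked on generators of J.\<close>

definition colon :: "'a::comm_ring_1 set \<Rightarrow> 'a \<Rightarrow> 'a set" where
  "colon I a = {j. a * j \<in> I}"

lemma is_ideal_colon: "is_ideal I \<Longrightarrow> is_ideal (colon I a)"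
  unfolding colon_def
  by (rule is_idealI) (auto simp: is_idealD distrib_left mult.left_commute)

text \<open>Each \<open>colon ?P a\<close> is an ideal, so one factor at a time passes from
  generators to the whole ideal: first from B to K with a in A fixed, then from A to J with b in K
  fixed. This yields finite generation of products.\<close>

lemma ideal_prod_gen:
  assumes "J = ideal_gen A" "K = ideal_gen B"
  shows "ideal_prod J K = ideal_gen ((\<lambda>(a, b). a * b) ` (A \<times> B))"
proof
  let ?P = "ideal_gen ((\<lambda>(a, b). a * b) ` (A \<times> B))"
  have *: "a * b \<in> ?P" if "a \<in> A" "b \<in> B" for a b
    by (rule ideal_gen_base) (use that in auto)
  have "B \<subseteq> colon ?P a" if "a \<in> A" for a
    using * that by (auto simp: colon_def)
  then have "K \<subseteq> colon ?P a" if "a \<in> A" for a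
    using that by (simp add: assms ideal_gen_least is_ideal_colon)
  then have "A \<subseteq> colon ?P b" if "b \<in> K" for b
    using that by (auto simp: colon_def mult.commute)
  then have "J \<subseteq> colon ?P b" if "b \<in> K" for b
    using that by (simp add: assms(1) ideal_gen_least is_ideal_colon)
  then have "b * a \<in> ?P" if "a \<in> J" "b \<in> K" for a b
    using that by (auto simp: colon_def)
  then show "ideal_prod J K \<subseteq> ?P"
    by (intro ideal_prod_least) (simp_all add: mult.commute)
  show "?P \<subseteq> ideal_prod J K"
    by (rule ideal_gen_least) (auto intro!: ideal_prod_memI simp: assms ideal_gen_base)
qed

lemma fin_gen_ideal_prod: "fin_gen_ideal J \<Longrightarrow> fin_gen_ideal K \<Longrightarrow> fin_gen_ideal (ideal_prod J K)"
  unfolding fin_gen_ideal_def using ideal_prod_gen by (metis finite_SigmaI finite_imageI)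


section \<open>Glaz-Vasconcelos ideals\<close>

text \<open>Linearity on J of a total function whose values outside J stay free. Unlike the
  extensional members of \<open>Hom_to_ring\<close>, such maps can be written down without
  \<open>restrict\<close>.\<close>

definition hom_on :: "'a::comm_ring_1 set \<Rightarrow> ('a \<Rightarrow> 'a) \<Rightarrow> bool" where
  "hom_on J f \<longleftrightarrow>
     (\<forall>a\<in>J. \<forall>b\<in>J. f (a + b) = f a + f b) \<and> (\<forall>r. \<forall>a\<in>J. f (r * a) = r * f a)"

lemma hom_on_zero:
  assumes "hom_on J f" "is_ideal J"
  shows "f 0 = 0"
  using assms(1) is_idealD(1)[OF assms(2)] unfolding hom_on_def
  by (metis mult_zero_left)

lemma hom_on_sum:
  assumes "hom_on J f" "is_ideal J" "\<And>x. x \<in> A \<Longrightarrow> g x \<in> J"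
  shows "f (sum g A) = (\<Sum>x\<in>A. f (g x))"
  using assms(3)
proof (induction A rule: infinite_finite_induct)
  case (insert x A)
  then have "g x \<in> J" "sum g A \<in> J" using assms(2) by (auto intro: is_ideal_sum)
  then show ?case using insert assms(1) by (simp add: hom_on_def)
qed (simp_all add: hom_on_zero[OF assms(1,2)])

lemma hom_on_gen_eq:
  assumes f: "hom_on J f" and J: "J = ideal_gen A" and eq: "\<And>a. a \<in> A \<Longrightarrow> f a = r * a"
  shows "\<forall>a\<in>J. f a = r * a"
proof -
  have I: "is_ideal J" by (simp add: J)
  have "is_ideal {a\<in>J. f a = r * a}"
    by (rule is_idealI)
      (use f I in \<open>auto simp: is_idealD hom_on_zero distrib_left mult.left_commute hom_on_def\<close>)
  moreover have "A \<subseteq> {a\<in>J. f a = r * a}"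
    using eq by (auto simp: J ideal_gen_base)
  ultimately show ?thesis using ideal_gen_least J by blast
qed

lemma hom_on_restrict:
  assumes "is_ideal J"
  shows "restrict f J \<in> Hom_to_ring J \<longleftrightarrow> hom_on J f"
  using assms by (auto simp: Hom_to_ring_def hom_on_def is_idealD)

text \<open>Bijectivity of \<phi> splits in two: it is injective iff no nonzero element annihilates
  J, and surjective iff every linear map on J is a multiplication.\<close>

lemma GV_iff:
  "J \<in> GV \<longleftrightarrow> fin_gen_ideal J \<and> (\<forall>r. (\<forall>a\<in>J. r * a = 0) \<longrightarrow> r = 0) \<and>
     (\<forall>f. hom_on J f \<longrightarrow> (\<exists>r. \<forall>a\<in>J. f a = r * a))"
proof (cases "fin_gen_ideal J")
  case True
  then have J: "is_ideal J" by (rule fin_gen_idealD)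
  let ?m = "\<lambda>r. \<lambda>a\<in>J. r * a"
  have "inj ?m \<longleftrightarrow> (\<forall>r. (\<forall>a\<in>J. r * a = 0) \<longrightarrow> r = 0)"
  proof
    assume inj: "inj ?m"
    show "\<forall>r. (\<forall>a\<in>J. r * a = 0) \<longrightarrow> r = 0"
    proof (intro allI impI)
      fix r assume "\<forall>a\<in>J. r * a = 0"
      then have "?m r = ?m 0" by (auto simp: fun_eq_iff)
      then show "r = 0" using inj by (meson injD)
    qed
  next
    assume ann: "\<forall>r. (\<forall>a\<in>J. r * a = 0) \<longrightarrow> r = 0"
    show "inj ?m"
    proof (rule injI)
      fix r s assume eq: "?m r = ?m s"
      have "(r - s) * a = 0" if "a \<in> J" for a
        using fun_cong[OF eq, of a] that by (simp add: left_diff_distrib)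
      then have "r - s = 0" using ann by blast
      then show "r = s" by simp
    qed
  qed
  moreover have "?m ` UNIV = Hom_to_ring J \<longleftrightarrow> (\<forall>f. hom_on J f \<longrightarrow> (\<exists>r. \<forall>a\<in>J. f a = r * a))"
  proof
    assume im: "?m ` UNIV = Hom_to_ring J"
    show "\<forall>f. hom_on J f \<longrightarrow> (\<exists>r. \<forall>a\<in>J. f a = r * a)"
    proof (intro allI impI)
      fix f assume "hom_on J f"
      then have "restrict f J \<in> ?m ` UNIV" using hom_on_restrict[OF J] im by blast
      then obtain r where "restrict f J = ?m r" by blast
      then have "f a = r * a" if "a \<in> J" for a
        using that by (metis restrict_apply')
      then show "\<exists>r. \<forall>a\<in>J. f a = r * a" by blast
    qed
  next
    assume mult: "\<forall>f. hom_on J f \<longrightarrow> (\<exists>r. \<forall>a\<in>J. f a = r * a)"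
    have "hom_on J ((*) r)" for r
      by (auto simp: hom_on_def algebra_simps)
    then have "?m r \<in> Hom_to_ring J" for r
      using hom_on_restrict[OF J] by auto
    moreover have "f \<in> ?m ` UNIV" if "f \<in> Hom_to_ring J" for f
    proof -
      have ext: "f = restrict f J"
        using that by (auto simp: Hom_to_ring_def PiE_def extensional_restrict)
      then have "hom_on J f" using hom_on_restrict[OF J] that by metis
      then obtain r where "\<forall>a\<in>J. f a = r * a" using mult by blast
      then have "f = ?m r" by (subst ext) auto
      then show ?thesis by blast
    qed
    ultimately show "?m ` UNIV = Hom_to_ring J" by blast
  qed
  ultimately show ?thesis using True by (simp add: GV_def bij_betw_def)
qed (simp add: GV_def)

lemma
  assumes "J \<in> GV"
  shows GV_fin_gen: "fin_gen_ideal J"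
    and GV_is_ideal: "is_ideal J"
    and GV_faithful: "(\<And>a. a \<in> J \<Longrightarrow> r * a = 0) \<Longrightarrow> r = 0"
    and GV_hom: "hom_on J f \<Longrightarrow> \<exists>r. \<forall>a\<in>J. f a = r * a"
  using assms by (auto simp: GV_iff fin_gen_idealD)

lemma UNIV_in_GV [simp]: "UNIV \<in> GV"
  unfolding GV_iff
proof (intro conjI allI impI)
  fix r :: 'a assume "\<forall>a\<in>UNIV. r * a = 0"
  then show "r = 0" by (metis UNIV_I mult_1_right)
next
  fix f :: "'a \<Rightarrow> 'a" assume "hom_on UNIV f"
  then have "f a = f 1 * a" for a
    unfolding hom_on_def by (metis UNIV_I mult.commute mult_1_right)
  then show "\<exists>r. \<forall>a\<in>UNIV. f a = r * a" by blast
qed simp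

text \<open>For fixed a in J the map b \<mapsto> f(ab) is linear on K, hence multiplication by some
  g(a). Faithfulness of K makes g linear on J, so g is multiplication by some r, and f agrees with r
  on the generators ab.\<close>

lemma ideal_prod_in_GV:
  assumes J: "J \<in> GV" and K: "K \<in> GV"
  shows "ideal_prod J K \<in> GV"
  unfolding GV_iff
proof (intro conjI allI impI)
  show "fin_gen_ideal (ideal_prod J K)"
    using assms by (simp add: GV_fin_gen fin_gen_ideal_prod)
next
  fix r assume r: "\<forall>a\<in>ideal_prod J K. r * a = 0"
  have "r * a = 0" if "a \<in> J" for a
  proof (rule GV_faithful[OF K])
    fix b assume "b \<in> K"
    then show "r * a * b = 0" using r that ideal_prod_memI[of a J b K] by (simp add: mult.assoc)
  qed
  then show "r = 0" using GV_faithful[OF J] by blast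
next
  fix f assume f: "hom_on (ideal_prod J K) f"
  have "hom_on K (\<lambda>b. f (a * b))" if "a \<in> J" for a
    using f that unfolding hom_on_def
    by (auto simp: distrib_left ideal_prod_memI mult.left_commute)
  then have "\<forall>a\<in>J. \<exists>r. \<forall>b\<in>K. f (a * b) = r * b" using GV_hom[OF K] by blast
  then obtain g where g: "f (a * b) = g a * b" if "a \<in> J" "b \<in> K" for a b by metis
  have "hom_on J g"
    unfolding hom_on_def
  proof (intro conjI allI ballI)
    fix a a' assume a: "a \<in> J" "a' \<in> J"
    have "(g (a + a') - (g a + g a')) * b = 0" if b: "b \<in> K" for b
    proof -
      have "g (a + a') * b = f ((a + a') * b)"
        using g[of "a + a'" b] a b is_idealD(2)[OF GV_is_ideal[OF J]] by simp
      also have "\<dots> = f (a * b) + f (a' * b)"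
        using f a b by (simp add: hom_on_def distrib_right ideal_prod_memI)
      finally show ?thesis using g a b by (simp add: algebra_simps)
    qed
    then have "g (a + a') - (g a + g a') = 0" using GV_faithful[OF K] by blast
    then show "g (a + a') = g a + g a'" by simp
  next
    fix r a assume a: "a \<in> J"
    have "(g (r * a) - r * g a) * b = 0" if b: "b \<in> K" for b
    proof -
      have "g (r * a) * b = f (r * a * b)"
        using g[of "r * a" b] a b is_idealD(3)[OF GV_is_ideal[OF J]] by simp
      also have "\<dots> = r * f (a * b)"
        using f a b by (simp add: hom_on_def mult.assoc ideal_prod_memI)
      finally show ?thesis using g a b by (simp add: algebra_simps)
    qed
    then have "g (r * a) - r * g a = 0" using GV_faithful[OF K] by blast
    then show "g (r * a) = r * g a" by simp
  qed
  then obtain r where r: "\<forall>a\<in>J. g a = r * a" using GV_hom[OF J] by blast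
  have "f c = r * c" if "c \<in> {a * b |a b. a \<in> J \<and> b \<in> K}" for c
    using that r g by (auto simp: mult.assoc)
  from hom_on_gen_eq[OF f ideal_prod_def this]
  show "\<exists>r. \<forall>a\<in>ideal_prod J K. f a = r * a" by blast
qed

text \<open>Multiplication by x is a linear map from J to R, hence multiplication by some r. Writing
  x = b/s, faithfulness of J gives b = rs, even if J contains no regular element.\<close>

lemma GV_tq_inverse:
  assumes J: "J \<in> GV" and x: "\<And>j. j \<in> J \<Longrightarrow> x * tq_of j \<in> range tq_of"
  shows "x \<in> range tq_of"
proof -
  have "\<forall>j\<in>J. \<exists>a. x * tq_of j = tq_of a" using x by blast
  then obtain f where f: "x * tq_of j = tq_of (f j)" if "j \<in> J" for j by metis
  note I = is_idealD[OF GV_is_ideal[OF J]]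
  have "hom_on J f"
    unfolding hom_on_def
  proof (intro conjI allI ballI)
    fix a b assume "a \<in> J" "b \<in> J"
    then have "tq_of (f (a + b)) = tq_of (f a + f b)"
      using f[of "a + b"] f[of a] f[of b] I by (simp add: tq_of_add distrib_left)
    then show "f (a + b) = f a + f b" by simp
  next
    fix r a assume "a \<in> J"
    then have "tq_of (f (r * a)) = tq_of (r * f a)"
      using f[of "r * a"] f[of a] I by (metis tq_of_mult mult.left_commute)
    then show "f (r * a) = r * f a" by simp
  qed
  then obtain r where r: "\<forall>a\<in>J. f a = r * a" using GV_hom[OF J] by blast
  obtain b s where s: "regular s" and b: "x * tq_of s = tq_of b"
    using tq_is_fraction by blast
  have "(b - r * s) * j = 0" if "j \<in> J" for j
  proof -
    have "tq_of (b * j) = tq_of (r * s * j)"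
      using f[OF that] r that by (simp add: tq_of_mult flip: b) (metis mult.commute mult.left_commute)
    then show ?thesis by (simp add: left_diff_distrib)
  qed
  then have "b - r * s = 0" using GV_faithful[OF J] by blast
  then have "x * tq_of s = tq_of r * tq_of s" using b by (simp add: tq_of_mult)
  then have "x * (tq_of s * tq_inverse_of s) = tq_of r * (tq_of s * tq_inverse_of s)"
    by (metis mult.assoc)
  then show ?thesis by (simp add: tq_of_times_inverse[OF s])
qed

text \<open>If s in J is regular, then s f(a) = a f(s) shows that a linear f is multiplication by
  f(s)/s in the total quotient ring, and this fraction lies in J^{-1} = R. The converse inclusion
  rests on \<open>GV_tq_inverse\<close>.\<close>

lemma rGV_eq: "rGV = {J \<in> (GV :: 'a::comm_ring_1 set set). regular_ideal J}"
proof (rule subset_antisym; rule subsetI)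
  fix J :: "'a set" assume "J \<in> rGV"
  then have fg: "fin_gen_ideal J" and reg: "regular_ideal J"
    and inv: "tq_inverse (tq_of ` J) = range tq_of" by (simp_all add: rGV_def)
  obtain s where s: "s \<in> J" "regular s" using reg unfolding regular_ideal_def by blast
  have "J \<in> GV"
    unfolding GV_iff
  proof (intro conjI allI impI fg)
    fix r assume "\<forall>a\<in>J. r * a = 0"
    then have "r * s = 0" using s by blast
    then have "s * r = 0" by (simp only: mult.commute)
    then show "r = 0" using s by (auto simp: regular_def)
  next
    fix f assume f: "hom_on J f"
    define x where "x = tq_of (f s) * tq_inverse_of s"
    have x: "x * tq_of a = tq_of (f a)" if "a \<in> J" for a
    proof -
      have "f (s * a) = s * f a" "f (a * s) = a * f s"
        using f s that by (auto simp: hom_on_def)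
      then have eq: "tq_of (f s) * tq_of a = tq_of s * tq_of (f a)"
        by (simp add: mult.commute flip: tq_of_mult)
      have "x * tq_of a = (tq_of (f s) * tq_of a) * tq_inverse_of s"
        by (simp add: x_def ac_simps)
      also have "\<dots> = tq_of (f a) * (tq_of s * tq_inverse_of s)"
        unfolding eq by (simp add: ac_simps)
      finally have "x * tq_of a = tq_of (f a) * (tq_of s * tq_inverse_of s)" .
      then show ?thesis by (simp add: tq_of_times_inverse s)
    qed
    then have "x \<in> tq_inverse (tq_of ` J)" by (simp add: tq_inverse_def)
    then obtain r where "x = tq_of r" using inv by blast
    then have "tq_of (f a) = tq_of (r * a)" if "a \<in> J" for a
      using x[OF that] by (simp only: tq_of_mult)
    then show "\<exists>r. \<forall>a\<in>J. f a = r * a" unfolding tq_of_inject by blast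
  qed
  then show "J \<in> {J \<in> GV. regular_ideal J}" using reg by simp
next
  fix J :: "'a set" assume J: "J \<in> {J \<in> GV. regular_ideal J}"
  then have "tq_inverse (tq_of ` J) \<subseteq> range tq_of"
    unfolding tq_inverse_def using GV_tq_inverse[of J] by blast
  moreover have "range tq_of \<subseteq> tq_inverse (tq_of ` J)"
    unfolding tq_inverse_def by (simp add: image_subset_iff flip: tq_of_mult)
  ultimately have "tq_inverse (tq_of ` J) = range tq_of" by (rule subset_antisym)
  then show "J \<in> rGV" using J by (simp add: rGV_def GV_fin_gen)
qed

section \<open>Closure operations given by a system of Glaz-Vasconcelos ideals\<close>

definition closure_by :: "'a::comm_ring_1 set set \<Rightarrow> 'a tq set \<Rightarrow> 'a tq set" where
  "closure_by G I = {x. \<exists>J\<in>G. \<forall>j\<in>J. x * tq_of j \<in> I}"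

lemma u_closure_eq: "u_closure = closure_by rGV"
  by (simp add: fun_eq_iff u_closure_def closure_by_def)

lemma w_closure_eq: "w_closure = closure_by GV"
  by (simp add: fun_eq_iff w_closure_def closure_by_def)

text \<open>The closure computed inside R; \<open>closure_by_image\<close> shows that it agrees with
  the one taken in T(R).\<close>

definition ring_closure :: "'a::comm_ring_1 set set \<Rightarrow> 'a set \<Rightarrow> 'a set" where
  "ring_closure G I = {a. \<exists>J\<in>G. J \<subseteq> colon I a}"

definition closed_ideal :: "'a::comm_ring_1 set set \<Rightarrow> 'a set \<Rightarrow> bool" where
  "closed_ideal G I \<longleftrightarrow> is_ideal I \<and> ring_closure G I \<subseteq> I"

lemma closed_idealD:
  "closed_ideal G I \<Longrightarrow> is_ideal I"
  "closed_ideal G I \<Longrightarrow> J \<in> G \<Longrightarrow> (\<And>j. j \<in> J \<Longrightarrow> a * j \<in> I) \<Longrightarrow> a \<in> I"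
  by (auto simp: closed_ideal_def ring_closure_def colon_def)

lemma ring_closure_mono: "I \<subseteq> I' \<Longrightarrow> ring_closure G I \<subseteq> ring_closure G I'"
  by (auto simp: ring_closure_def colon_def)

text \<open>These properties are common to \<open>GV\<close> and \<open>rGV\<close>, so u and w are
  treated at once.\<close>

locale gv_system =
  fixes G :: "'a::comm_ring_1 set set"
  assumes subset_GV: "G \<subseteq> GV"
    and UNIV_mem: "UNIV \<in> G"
    and prod_mem: "J \<in> G \<Longrightarrow> K \<in> G \<Longrightarrow> ideal_prod J K \<in> G"

lemma gv_system_GV: "gv_system GV"
  by unfold_locales (simp_all add: ideal_prod_in_GV)

lemma gv_system_rGV: "gv_system rGV"
proof unfold_locales
  show "UNIV \<in> (rGV :: 'a set set)"
    using regular_1 by (auto simp: rGV_eq regular_ideal_def simp del: regular_1)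
  fix J K :: "'a set" assume "J \<in> rGV" "K \<in> rGV"
  then obtain a b where "J \<in> GV" "K \<in> GV" "a \<in> J" "b \<in> K" "regular (a * b)"
    by (auto simp: rGV_eq regular_ideal_def)
  then show "ideal_prod J K \<in> rGV"
    using ideal_prod_in_GV[of J K] ideal_prod_memI[of a J b K]
    by (auto simp: rGV_eq regular_ideal_def)
qed (auto simp: rGV_eq)

context gv_system
begin

lemma mem_is_ideal: "J \<in> G \<Longrightarrow> is_ideal J"
  using subset_GV GV_is_ideal by blast

text \<open>Members of G are ideals, so the product of finitely many of them lies in each
  factor.\<close>

lemma common_lower_bound:
  assumes "finite A" "\<And>a. a \<in> A \<Longrightarrow> \<exists>J\<in>G. J \<subseteq> Q a"
  shows "\<exists>L\<in>G. \<forall>a\<in>A. L \<subseteq> Q a"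
  using assms
proof (induction A rule: finite_induct)
  case empty
  then show ?case using UNIV_mem by blast
next
  case (insert x A)
  then obtain L J where "L \<in> G" "J \<in> G" "\<forall>a\<in>A. L \<subseteq> Q a" "J \<subseteq> Q x" by blast
  then show ?case
    using ideal_prod_subset[of L J] mem_is_ideal prod_mem[of L J]
    by (intro bexI[of _ "ideal_prod L J"]) auto
qed

lemma ring_closure_superset:
  assumes "is_ideal I"
  shows "I \<subseteq> ring_closure G I"
  using UNIV_mem is_idealD[OF assms] by (auto simp: ring_closure_def colon_def)

text \<open>If aJ lies in the closure of I, finite generation of J gives a single L in G with ajL
  \<subseteq> I for all generators j. Then aJL \<subseteq> I, and JL is again in G.\<close>

lemma ring_closure_idem:
  assumes I: "is_ideal I"
  shows "ring_closure G (ring_closure G I) \<subseteq> ring_closure G I"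
proof
  fix a assume "a \<in> ring_closure G (ring_closure G I)"
  then obtain J where J: "J \<in> G" and sub: "\<And>j. j \<in> J \<Longrightarrow> \<exists>K\<in>G. K \<subseteq> colon I (a * j)"
    by (auto simp: ring_closure_def colon_def)
  obtain A where A: "finite A" "J = ideal_gen A"
    using J subset_GV GV_fin_gen unfolding fin_gen_ideal_def by blast
  then obtain L where L: "L \<in> G" "\<And>j. j \<in> A \<Longrightarrow> L \<subseteq> colon I (a * j)"
    using common_lower_bound[of A "\<lambda>j. colon I (a * j)"] sub ideal_gen_base by metis
  have swap: "a * l * j \<in> I" if "a * j * l \<in> I" for j l
    using that by (simp only: ac_simps)
  have "A \<subseteq> colon I (a * l)" if "l \<in> L" for l
    using L(2) that by (auto simp: colon_def subset_iff swap)
  then have "J \<subseteq> colon I (a * l)" if "l \<in> L" for l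
    using that A by (simp add: ideal_gen_least is_ideal_colon I)
  then have "a * j * l \<in> I" if "j \<in> J" "l \<in> L" for j l
    using that by (auto simp: colon_def intro: swap)
  then have "ideal_prod J L \<subseteq> colon I a"
    by (intro ideal_prod_least is_ideal_colon I) (simp add: colon_def mult.assoc)
  then show "a \<in> ring_closure G I"
    using prod_mem[OF J L(1)] by (auto simp: ring_closure_def)
qed

lemma is_ideal_ring_closure:
  assumes I: "is_ideal I"
  shows "is_ideal (ring_closure G I)"
proof (rule is_idealI)
  show "0 \<in> ring_closure G I"
    using ring_closure_superset[OF I] is_idealD(1)[OF I] by blast
next
  fix a b assume "a \<in> ring_closure G I" "b \<in> ring_closure G I"
  then obtain J K where J: "J \<in> G" "J \<subseteq> colon I a" and K: "K \<in> G" "K \<subseteq> colon I b"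
    by (auto simp: ring_closure_def)
  then have "ideal_prod J K \<subseteq> colon I (a + b)"
    using ideal_prod_subset[of J K] mem_is_ideal I
    by (auto simp: colon_def distrib_right subset_iff intro!: is_idealD(2))
  then show "a + b \<in> ring_closure G I"
    using prod_mem J K by (auto simp: ring_closure_def)
next
  fix r a assume "a \<in> ring_closure G I"
  then show "r * a \<in> ring_closure G I"
    using is_idealD(3)[OF I] by (auto simp: ring_closure_def colon_def mult.assoc)
qed

lemma closed_ring_closure: "is_ideal I \<Longrightarrow> closed_ideal G (ring_closure G I)"
  by (simp add: closed_ideal_def is_ideal_ring_closure ring_closure_idem)

text \<open>If xJ \<subseteq> I for some J in G, then xJ lies in R and J^{-1} = R forces x into R.
  Hence the closure of a subset of R can be taken inside R.\<close>

lemma closure_by_image: "closure_by G (tq_of ` I) = tq_of ` ring_closure G I"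
proof (rule subset_antisym; rule subsetI)
  fix x assume "x \<in> closure_by G (tq_of ` I)"
  then obtain J where J: "J \<in> G" "\<And>j. j \<in> J \<Longrightarrow> x * tq_of j \<in> tq_of ` I"
    by (auto simp: closure_by_def)
  then have "x \<in> range tq_of" using GV_tq_inverse[of J x] subset_GV by blast
  then obtain a where a: "x = tq_of a" by blast
  then have "J \<subseteq> colon I a" using J(2) by (auto simp: colon_def image_iff simp flip: tq_of_mult)
  then show "x \<in> tq_of ` ring_closure G I" using J(1) a by (auto simp: ring_closure_def)
next
  fix x assume "x \<in> tq_of ` ring_closure G I"
  then show "x \<in> closure_by G (tq_of ` I)"
    by (auto simp: closure_by_def ring_closure_def colon_def subset_iff simp flip: tq_of_mult)
      blast
qed

lemma integral_star_ideal_iff: "integral_star_ideal (closure_by G) I \<longleftrightarrow> closed_ideal G I"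
proof -
  have "inj (tq_of :: 'a \<Rightarrow> 'a tq)" by (simp add: inj_def)
  then have "integral_star_ideal (closure_by G) I \<longleftrightarrow> is_ideal I \<and> ring_closure G I = I"
    by (simp add: integral_star_ideal_def closure_by_image inj_image_eq_iff)
  then show ?thesis using ring_closure_superset by (auto simp: closed_ideal_def)
qed

text \<open>The closure of an ideal is all of R iff it contains 1, and 1 is in the closure iff the
  ideal itself contains a member of G.\<close>

lemma N_star_iff: "f \<in> N_star (closure_by G) \<longleftrightarrow> (\<exists>J\<in>G. J \<subseteq> content_ideal f)"
proof -
  have I: "is_ideal (ring_closure G (content_ideal f))"
    by (rule is_ideal_ring_closure) (simp add: content_ideal_def)
  have "inj (tq_of :: 'a \<Rightarrow> 'a tq)" by (simp add: inj_def)
  then have "f \<in> N_star (closure_by G) \<longleftrightarrow> ring_closure G (content_ideal f) = UNIV"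
    by (simp add: N_star_def closure_by_image inj_image_eq_iff)
  also have "\<dots> \<longleftrightarrow> 1 \<in> ring_closure G (content_ideal f)"
    using is_idealD(3)[OF I, of 1] by (metis UNIV_I UNIV_eq_I mult_1_right)
  finally show ?thesis by (simp add: ring_closure_def colon_def)
qed

lemma star_noetherian_iff:
  "star_noetherian (closure_by G) \<longleftrightarrow>
     (\<forall>I. (\<forall>n. closed_ideal G (I n)) \<and> (\<forall>n. I n \<subseteq> I (Suc n)) \<longrightarrow> (\<exists>n. \<forall>m\<ge>n. I m = I n))"
  by (simp add: star_noetherian_def integral_star_ideal_iff)

text \<open>Dependent choice turns the chain condition into a maximum condition: without a maximal
  member above I one could climb forever.\<close>

lemma exists_maximal_closed_ideal:
  assumes acc: "star_noetherian (closure_by G)"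
    and F: "\<And>I. I \<in> F \<Longrightarrow> closed_ideal G I" and I: "I \<in> F"
  shows "\<exists>M\<in>F. I \<subseteq> M \<and> (\<forall>K\<in>F. M \<subseteq> K \<longrightarrow> K = M)"
proof (rule ccontr)
  assume "\<not> ?thesis"
  then have no: "\<forall>M\<in>F. I \<subseteq> M \<longrightarrow> (\<exists>K\<in>F. M \<subseteq> K \<and> K \<noteq> M)" by simp
  have step: "\<exists>K. (K \<in> F \<and> I \<subseteq> K) \<and> M \<subset> K" if M: "M \<in> F \<and> I \<subseteq> M" for M
  proof -
    obtain K where "K \<in> F" "M \<subseteq> K" "K \<noteq> M"
      using no[rule_format, of M] M by blast
    then show ?thesis using M by (intro exI[of _ K]) auto
  qed
  have "\<exists>c. \<forall>n. (c n \<in> F \<and> I \<subseteq> c n) \<and> c n \<subset> c (Suc n)"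
    using I step by (intro dependent_nat_choice) auto
  then obtain c where c: "\<And>n. c n \<in> F" "\<And>n. c n \<subset> c (Suc n)" by blast
  then have "(\<forall>n. closed_ideal G (c n)) \<and> (\<forall>n. c n \<subseteq> c (Suc n))" using F by blast
  then obtain n where n: "\<forall>m\<ge>n. c m = c n"
    using acc[unfolded star_noetherian_iff] by blast
  have "c (Suc n) = c n" by (rule n[rule_format]) simp
  then show False using c(2)[of n] by simp
qed

text \<open>Among closures of ideals generated by finite subsets of I there is a maximal one, M.
  Adjoining any a in I to the finite set cannot enlarge M, so a lies in M.\<close>

lemma finite_type:
  assumes acc: "star_noetherian (closure_by G)" and I: "is_ideal I"
  shows "\<exists>A. finite A \<and> A \<subseteq> I \<and> I \<subseteq> ring_closure G (ideal_gen A)"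
proof -
  let ?F = "{ring_closure G (ideal_gen A) |A. finite A \<and> A \<subseteq> I}"
  have "closed_ideal G K" if "K \<in> ?F" for K
    using that closed_ring_closure by auto
  moreover have "ring_closure G (ideal_gen {}) \<in> ?F" by blast
  ultimately have "\<exists>M\<in>?F. ring_closure G (ideal_gen {}) \<subseteq> M \<and> (\<forall>K\<in>?F. M \<subseteq> K \<longrightarrow> K = M)"
    by (rule exists_maximal_closed_ideal[OF acc])
  then obtain M where M: "M \<in> ?F" and max: "\<forall>K\<in>?F. M \<subseteq> K \<longrightarrow> K = M"
    by (elim bexE conjE) (rule that)
  then obtain A where A: "finite A" "A \<subseteq> I" "M = ring_closure G (ideal_gen A)" by blast
  have "a \<in> M" if a: "a \<in> I" for a
  proof -
    have "ring_closure G (ideal_gen (insert a A)) \<in> ?F" using A a by blast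
    moreover have "M \<subseteq> ring_closure G (ideal_gen (insert a A))"
      unfolding A(3) by (rule ring_closure_mono, rule ideal_gen_mono) (auto intro: ideal_gen_base)
    ultimately have "ring_closure G (ideal_gen (insert a A)) = M" by (rule max[rule_format])
    then show ?thesis
      using ring_closure_superset[OF is_ideal_gen, of "insert a A"] ideal_gen_base by blast
  qed
  then show ?thesis using A by blast
qed

end


section \<open>Regularity of Glaz-Vasconcelos ideals\<close>

definition annih :: "'a::comm_ring_1 set \<Rightarrow> 'a set" where
  "annih S = {r. \<forall>s\<in>S. r * s = 0}"

lemma is_ideal_annih: "is_ideal (annih S)"
  unfolding annih_def by (rule is_idealI) (auto simp: distrib_right mult.assoc)

text \<open>If aJ annihilates s, then J annihilates as, and faithfulness of J gives as = 0. The
  chain condition thus applies to annihilators.\<close>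

lemma (in gv_system) closed_annih: "closed_ideal G (annih S)"
  unfolding closed_ideal_def
proof (intro conjI is_ideal_annih subsetI)
  fix a assume "a \<in> ring_closure G (annih S)"
  then obtain J where J: "J \<in> G" "\<And>j s. j \<in> J \<Longrightarrow> s \<in> S \<Longrightarrow> a * j * s = 0"
    by (auto simp: ring_closure_def colon_def annih_def)
  then have "a * s * j = 0" if "j \<in> J" "s \<in> S" for j s
    using J(2)[OF that] by (simp only: ac_simps)
  then have "a * s = 0" if "s \<in> S" for s
    using GV_faithful[of J "a * s"] J(1) subset_GV that by blast
  then show "a \<in> annih S" by (simp add: annih_def)
qed

section \<open>Maximal annihilators and prime avoidance\<close>

definition maxann :: "'a::comm_ring_1 set set" where
  "maxann = {annih {a} |a. a \<noteq> 0 \<and>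
     (\<forall>b. b \<noteq> 0 \<longrightarrow> annih {a} \<subseteq> annih {b} \<longrightarrow> annih {b} = annih {a})}"

text \<open>With P = ann(a) and y outside P, ya is nonzero and ann(a) \<subseteq> ann(ya), so
  maximality gives equality. If xy kills a, then x kills ya and so lies in P.\<close>

lemma maxann_prime:
  assumes "P \<in> maxann" "x * y \<in> P" "y \<notin> P"
  shows "x \<in> P"
proof -
  obtain a where a: "P = annih {a}" and
    max: "\<And>b. b \<noteq> 0 \<Longrightarrow> annih {a} \<subseteq> annih {b} \<Longrightarrow> annih {b} = annih {a}"
    using assms(1) by (auto simp: maxann_def)
  have "y * a \<noteq> 0" using assms(3) by (simp add: a annih_def)
  moreover have "annih {a} \<subseteq> annih {y * a}"
    by (auto simp: annih_def mult.left_commute[of _ y a])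
  ultimately have "annih {y * a} = annih {a}" by (rule max)
  moreover have "x \<in> annih {y * a}" using assms(2) by (simp add: a annih_def mult.assoc)
  ultimately show ?thesis by (simp add: a)
qed

lemma maxann_one: "P \<in> maxann \<Longrightarrow> 1 \<notin> P"
  by (auto simp: maxann_def annih_def)

lemma maxann_is_ideal: "P \<in> maxann \<Longrightarrow> is_ideal P"
  by (auto simp: maxann_def is_ideal_annih)

lemma maxann_maximal: "P \<in> maxann \<Longrightarrow> Q \<in> maxann \<Longrightarrow> P \<subseteq> Q \<Longrightarrow> P = Q"
  by (auto simp: maxann_def)

text \<open>Distinct members of \<open>maxann\<close> are incomparable, so each Q in M contains an
  element outside P. The product of such elements works because P is prime.\<close>

lemma maxann_separate:
  assumes "finite M" "M \<subseteq> maxann" "P \<in> maxann" "P \<notin> M"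
  shows "\<exists>c. c \<notin> P \<and> (\<forall>Q\<in>M. c \<in> Q)"
  using assms(1,2,4)
proof (induction M rule: finite_induct)
  case empty
  then show ?case using maxann_one[OF assms(3)] by blast
next
  case (insert Q M)
  then obtain c where c: "c \<notin> P" "\<forall>Q\<in>M. c \<in> Q" by blast
  obtain d where d: "d \<in> Q" "d \<notin> P"
    using insert maxann_maximal[of Q P] assms(3) by blast
  have "d * c \<notin> P" using maxann_prime[OF assms(3), of d c] c d by blast
  moreover have "\<forall>Q'\<in>insert Q M. d * c \<in> Q'"
    using c d insert.prems maxann_is_ideal by (auto intro: is_idealD)
  ultimately show ?case by blast
qed

text \<open>For distinct P_0, P_1, ... with P_n = ann(a_n), the annihilators of the intersections of
  P_i over i < n form an ascending chain of closed ideals. The chain is strict, because a_n belongs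
  to term n + 1 but not to term n.\<close>

lemma (in gv_system) finite_maxann:
  assumes acc: "star_noetherian (closure_by G)"
  shows "finite (maxann :: 'a set set)"
proof (rule ccontr)
  assume "infinite (maxann :: 'a set set)"
  then obtain P :: "nat \<Rightarrow> 'a set" where P: "inj P" "range P \<subseteq> maxann"
    using infinite_countable_subset by blast
  then have "\<forall>n. \<exists>a. P n = annih {a}" by (force simp: maxann_def)
  then obtain a where a: "\<And>n. P n = annih {a n}" by metis
  define I where "I n = annih (\<Inter>i<n. P i)" for n
  have "closed_ideal G (I n)" for n by (simp add: I_def closed_annih)
  moreover have "I n \<subseteq> I (Suc n)" for n by (auto simp: I_def annih_def)
  ultimately obtain n where n: "\<forall>m\<ge>n. I m = I n"
    using acc[unfolded star_noetherian_iff, rule_format, of I] by blast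
  have "I (Suc n) = I n" by (rule n[rule_format]) simp
  moreover have "a n \<in> I (Suc n)"
    by (auto simp: I_def annih_def a mult.commute)
  ultimately have an: "a n \<in> I n" by simp
  \<comment> \<open>If a_n were in term n, the intersection of the earlier primes would lie in P_n;
    separation gives an element of that intersection outside P_n.\<close>
  have "P n \<notin> P ` {..<n}" using P(1) by (auto simp: inj_def)
  then obtain c where "c \<notin> P n" "\<forall>Q\<in>P ` {..<n}. c \<in> Q"
    using maxann_separate[of "P ` {..<n}" "P n"] P(2) by blast
  then show False using an by (auto simp: I_def annih_def a mult.commute)
qed

text \<open>If ab = 0 with b nonzero, then a lies in ann(b), and the chain condition puts ann(b)
  inside a maximal annihilator.\<close>

lemma (in gv_system) zero_divisor_maxann:
  assumes acc: "star_noetherian (closure_by G)" and "\<not> regular (a :: 'a)"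
  shows "\<exists>P\<in>maxann. a \<in> P"
proof -
  obtain b where b: "a * b = 0" "b \<noteq> 0" using assms(2) by (auto simp: regular_def)
  let ?F = "{annih {c} |c :: 'a. c \<noteq> 0}"
  have "closed_ideal G K" if "K \<in> ?F" for K
    using that closed_annih by auto
  moreover have "annih {b} \<in> ?F" using b by blast
  ultimately have "\<exists>M\<in>?F. annih {b} \<subseteq> M \<and> (\<forall>K\<in>?F. M \<subseteq> K \<longrightarrow> K = M)"
    by (rule exists_maximal_closed_ideal[OF acc])
  then obtain c where c: "c \<noteq> 0" "annih {b} \<subseteq> annih {c}"
    and max: "\<forall>K\<in>?F. annih {c} \<subseteq> K \<longrightarrow> K = annih {c}" by blast
  then have "annih {d} = annih {c}" if "d \<noteq> 0" "annih {c} \<subseteq> annih {d}" for d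
    using max[rule_format, of "annih {d}"] that by blast
  then have "annih {c} \<in> maxann" unfolding maxann_def using c(1) by blast
  moreover have "a \<in> annih {b}" using b by (simp add: annih_def)
  ultimately show ?thesis using c(2) by blast
qed

text \<open>Prime avoidance by minimal choice: take a in J contained in as few members of
  \<open>maxann\<close> as possible. If a were a zero divisor, the element a + bc constructed below
  would lie in strictly fewer.\<close>

lemma (in gv_system) faithful_imp_regular:
  assumes acc: "star_noetherian (closure_by G)" and J: "is_ideal (J :: 'a set)"
    and faithful: "\<And>r. (\<And>a. a \<in> J \<Longrightarrow> r * a = 0) \<Longrightarrow> r = 0"
  shows "\<exists>a\<in>J. regular a"
proof (rule ccontr)
  assume no: "\<not> ?thesis"
  define V where "V a = {P\<in>maxann. a \<in> P}" for a :: 'a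
  have fin: "finite (V a)" for a using finite_maxann[OF acc] by (simp add: V_def)
  obtain a where a: "a \<in> J" "\<And>b. b \<in> J \<Longrightarrow> card (V a) \<le> card (V b)"
    using arg_min_nat_le[of "\<lambda>a. a \<in> J" _ "\<lambda>a. card (V a)"]
      arg_min_natI[of "\<lambda>a. a \<in> J" _ "\<lambda>a. card (V a)"] is_idealD(1)[OF J] by metis
  obtain P where P: "P \<in> maxann" "a \<in> P" using zero_divisor_maxann[OF acc] no a(1) by blast
  obtain z where z: "P = annih {z}" "z \<noteq> 0" using P(1) by (auto simp: maxann_def)
  \<comment> \<open>J is not inside P = ann(z), since it would then annihilate the nonzero
    z.\<close>
  then obtain b where b: "b \<in> J" "b \<notin> P"
    using faithful[of z] by (auto simp: annih_def mult.commute)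
  \<comment> \<open>c avoids P but lies in every member of \<open>maxann\<close> that does not
    contain a. So adding bc to a puts the sum into no new prime and takes it out of P.\<close>
  obtain c where c: "c \<notin> P" "\<forall>Q\<in>maxann - V a. c \<in> Q"
    using maxann_separate[of "maxann - V a" P] finite_maxann[OF acc] P by (auto simp: V_def)
  let ?d = "b * c"
  have dJ: "?d \<in> J" using b J by (simp add: is_idealD)
  have dP: "?d \<notin> P" using maxann_prime[OF P(1), of b c] b c by blast
  have "Q \<in> V a" if Q: "Q \<in> V (a + ?d)" for Q
  proof (rule ccontr)
    assume "Q \<notin> V a"
    then have *: "Q \<in> maxann" "c \<in> Q" "a \<notin> Q" "a + ?d \<in> Q" using Q c by (auto simp: V_def)
    note Q' = maxann_is_ideal[OF *(1)]
    have "?d \<in> Q" by (rule is_idealD(3)[OF Q' *(2)])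
    then have "(a + ?d) - ?d \<in> Q" by (rule is_ideal_diff[OF Q' *(4)])
    then show False using * by simp
  qed
  moreover have "P \<notin> V (a + ?d)"
  proof
    assume "P \<in> V (a + ?d)"
    then have "a + ?d \<in> P" by (simp add: V_def)
    then have "(a + ?d) - a \<in> P" using P(2) by (rule is_ideal_diff[OF maxann_is_ideal[OF P(1)]])
    then show False using dP by simp
  qed
  moreover have "P \<in> V a" using P by (simp add: V_def)
  ultimately have "V (a + ?d) \<subset> V a" by blast
  then have "card (V (a + ?d)) < card (V a)" by (rule psubset_card_mono[OF fin])
  then show False using a dJ J is_idealD(2) by (metis not_less)
qed

text \<open>Enlarging G enlarges closures, hence leaves fewer closed ideals and fewer
  chains.\<close>

lemma star_noetherian_mono:
  assumes "gv_system G" "gv_system H" "G \<subseteq> H" "star_noetherian (closure_by G)"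
  shows "star_noetherian (closure_by H)"
proof -
  have "closed_ideal G I" if "closed_ideal H I" for I
    using that assms(3) by (auto simp: closed_ideal_def ring_closure_def)
  then show ?thesis
    using assms(4) unfolding gv_system.star_noetherian_iff[OF assms(1)]
      gv_system.star_noetherian_iff[OF assms(2)] by blast
qed

lemma rGV_eq_GV:
  assumes "w_noetherian TYPE('a::comm_ring_1)"
  shows "(rGV :: 'a set set) = GV"
proof -
  have "star_noetherian (closure_by (GV :: 'a set set))"
    using assms by (simp add: w_noetherian_def w_closure_eq)
  then have "regular_ideal J" if "J \<in> GV" for J :: "'a set"
    unfolding regular_ideal_def
    using gv_system.faithful_imp_regular[OF gv_system_GV] GV_is_ideal[OF that] GV_faithful[OF that]
    by blast
  then show ?thesis by (auto simp: rGV_eq)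
qed

lemma u_noetherian_iff_w_noetherian:
  "u_noetherian TYPE('a::comm_ring_1) \<longleftrightarrow> w_noetherian TYPE('a)"
proof
  assume "u_noetherian TYPE('a)"
  then show "w_noetherian TYPE('a)"
    using star_noetherian_mono[OF gv_system_rGV gv_system_GV]
    by (auto simp: u_noetherian_def w_noetherian_def u_closure_eq w_closure_eq rGV_eq)
next
  assume w: "w_noetherian TYPE('a)"
  then show "u_noetherian TYPE('a)"
    using rGV_eq_GV[OF w] by (simp add: u_noetherian_def w_noetherian_def u_closure_eq w_closure_eq)
qed

section \<open>Polynomials\<close>

text \<open>For an ideal I this is the extension I[X] = I R[X], described by coefficients rather
  than generators.\<close>

definition poly_ideal :: "'a::comm_ring_1 set \<Rightarrow> 'a poly set" where
  "poly_ideal I = {f. \<forall>i. poly.coeff f i \<in> I}"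

lemma is_ideal_poly_ideal:
  assumes I: "is_ideal I"
  shows "is_ideal (poly_ideal I)"
proof (rule is_idealI)
  fix r f assume "f \<in> poly_ideal I"
  then show "r * f \<in> poly_ideal I"
    unfolding poly_ideal_def coeff_mult mem_Collect_eq
    by (intro allI is_ideal_sum[OF I] is_idealD(3)[OF I]) blast
qed (use is_idealD[OF I] in \<open>simp_all add: poly_ideal_def\<close>)

lemma monom_in_poly_ideal: "is_ideal I \<Longrightarrow> a \<in> I \<Longrightarrow> Polynomial.monom a n \<in> poly_ideal I"
  by (simp add: poly_ideal_def is_idealD(1))

lemma coeff_in_content_ideal: "poly.coeff f i \<in> content_ideal f"
  unfolding content_ideal_def by (rule ideal_gen_base) simp

lemma content_ideal_subset_iff: "is_ideal I \<Longrightarrow> content_ideal f \<subseteq> I \<longleftrightarrow> f \<in> poly_ideal I"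
  using coeff_in_content_ideal[of f] ideal_gen_least[of "range (poly.coeff f)" I]
  by (auto simp: content_ideal_def poly_ideal_def)

lemma is_ideal_content_ideal [simp]: "is_ideal (content_ideal f)"
  by (simp add: content_ideal_def)

text \<open>This is the contraction to R of the quotient (B : f) in R[X]. Whether it contains an
  ideal J of R can be checked on generators of J.\<close>

lemma is_ideal_constants: "is_ideal B \<Longrightarrow> is_ideal {a. [:a:] * f \<in> B}"
proof (rule is_idealI)
  assume B: "is_ideal B"
  show "0 \<in> {a. [:a:] * f \<in> B}" using is_idealD(1)[OF B] by simp
  show "a + b \<in> {a. [:a:] * f \<in> B}"
    if "a \<in> {a. [:a:] * f \<in> B}" "b \<in> {a. [:a:] * f \<in> B}" for a b
    using is_idealD(2)[OF B, of "[:a:] * f" "[:b:] * f"] that by (simp add: smult_add_left)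
  show "r * a \<in> {a. [:a:] * f \<in> B}" if "a \<in> {a. [:a:] * f \<in> B}" for r a
    using is_idealD(3)[OF B, of "[:a:] * f" "[:r:]"] that by (simp add: mult.commute)
qed

text \<open>This replaces the Dedekind-Mertens formula: no power of the content of f is needed, because
  the hypothesis on I lets one divide by all the coefficients of f at once.\<close>

lemma poly_ideal_cancel:
  assumes I: "is_ideal I"
    and cancel: "\<And>a. (\<And>i. poly.coeff f i * a \<in> I) \<Longrightarrow> a \<in> I"
    and fg: "f * g \<in> poly_ideal I"
  shows "g \<in> poly_ideal I"
proof -
  note PI = is_ideal_poly_ideal[OF I]
  \<comment> \<open>Induction on a bound n for the length of g. The bound counts coefficients, so n
    = 0 means g = 0.\<close>
  have "g \<in> poly_ideal I" if "f * g \<in> poly_ideal I" "\<And>i. i \<ge> n \<Longrightarrow> poly.coeff g i = 0" for n g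
    using that
  proof (induction n arbitrary: g)
    case 0
    then have "g = 0" by (simp add: poly_eq_iff)
    then show ?case using is_idealD(1)[OF PI] by simp
  next
    case (Suc n)
    note prems = Suc.prems and IH = Suc.IH
    let ?b = "poly.coeff g n"
    \<comment> \<open>Descending induction on the index of the coefficient of f: k = 0 concerns only
      indices above the degree, and k = degree f + 1 covers all of them.\<close>
    have all: "\<forall>i. i + k > Polynomial.degree f \<longrightarrow> Polynomial.smult (poly.coeff f i) g \<in> poly_ideal I" for k
    proof (induction k)
      case 0
      then show ?case using is_idealD(1)[OF PI] by (simp add: coeff_eq_0)
    next
      case (Suc k)
      show ?case
      proof (intro allI impI)
        fix i assume i: "i + Suc k > Polynomial.degree f"
        let ?c = "poly.coeff f i"
        let ?t = "\<lambda>j. poly.coeff f j * poly.coeff g (i + n - j)"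
        \<comment> \<open>In the coefficient of fg at i + n, terms with j < i vanish by the bound on
          g, and terms with j > i lie in I by the inner induction. What remains is the product of
          \<open>?c\<close> and \<open>?b\<close>.\<close>
        have "?t j \<in> I" if "j \<in> {..i + n} - {i}" for j
        proof (cases "j < i")
          case True
          then have "poly.coeff g (i + n - j) = 0" using prems(2) by simp
          then show ?thesis using is_idealD(1)[OF I] by simp
        next
          case False
          then have "j + k > Polynomial.degree f" using that i by simp
          then have "Polynomial.smult (poly.coeff f j) g \<in> poly_ideal I" using Suc.IH by blast
          then show ?thesis by (simp add: poly_ideal_def)
        qed
        then have "(\<Sum>j\<in>{..i + n} - {i}. ?t j) \<in> I" by (rule is_ideal_sum[OF I])
        moreover have "poly.coeff (f * g) (i + n) \<in> I"
          using prems(1) by (simp add: poly_ideal_def)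
        moreover have "poly.coeff (f * g) (i + n) = ?c * ?b + (\<Sum>j\<in>{..i + n} - {i}. ?t j)"
          unfolding coeff_mult by (subst sum.remove[of _ i]) auto
        ultimately have cb: "?c * ?b \<in> I"
          using is_ideal_diff[OF I] by (metis add_diff_cancel_right')
        \<comment> \<open>Removing the term at X^n shortens the multiple of g, and f times the
          remainder stays in I[X], so the outer induction applies.\<close>
        let ?m = "Polynomial.monom (?c * ?b) n"
        let ?h = "Polynomial.smult ?c g - ?m"
        have m: "?m \<in> poly_ideal I" using cb by (rule monom_in_poly_ideal[OF I])
        have eq: "f * ?h = [:?c:] * (f * g) - f * ?m" by (simp add: right_diff_distrib)
        have "f * ?h \<in> poly_ideal I"
          unfolding eq by (intro is_ideal_diff[OF PI] is_idealD(3)[OF PI] prems(1) m)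
        moreover have "poly.coeff ?h j = 0" if "j \<ge> n" for j
          using prems(2)[of j] that by (cases "j = n") simp_all
        ultimately have "?h \<in> poly_ideal I" by (rule IH)
        then have "?h + ?m \<in> poly_ideal I" using m by (rule is_idealD(2)[OF PI])
        then show "Polynomial.smult ?c g \<in> poly_ideal I" by simp
      qed
    qed
    have "Polynomial.smult (poly.coeff f i) g \<in> poly_ideal I" for i
      using all[of "Suc (Polynomial.degree f)"] by simp
    then show ?case by (auto simp: poly_ideal_def intro: cancel)
  qed
  then show ?thesis using fg coeff_eq_0[of g] by (metis Suc_le_lessD)
qed

section \<open>Glaz-Vasconcelos ideals of R and of R[X]\<close>

text \<open>Taking the i-th coefficient of f(a) for constants a gives a linear map on
  \<open>ideal_gen A\<close>, hence multiplication by some r_i. Since almost all r_i vanish, they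
  form a polynomial that induces f.\<close>

lemma extension_in_GV:
  assumes A: "finite A" and J: "ideal_gen A \<in> GV"
  shows "ideal_gen ((\<lambda>a. [:a:]) ` A) \<in> GV"
proof -
  let ?E = "ideal_gen ((\<lambda>a. [:a:]) ` A)"
  have "A \<subseteq> {a. [:a:] * 1 \<in> ?E}" by (auto intro: ideal_gen_base)
  then have "ideal_gen A \<subseteq> {a. [:a:] * 1 \<in> ?E}"
    by (rule ideal_gen_least) (simp only: is_ideal_constants is_ideal_gen)
  then have const: "[:a:] \<in> ?E" if "a \<in> ideal_gen A" for a using that by auto
  show ?thesis
    unfolding GV_iff
  proof (intro conjI allI impI)
    show "fin_gen_ideal ?E" using A by (auto simp: fin_gen_ideal_def)
  next
    fix r assume r: "\<forall>a\<in>?E. r * a = 0"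
    have "poly.coeff r i * a = 0" if "a \<in> ideal_gen A" for i a
      using r const[OF that] by (metis coeff_0 coeff_smult mult.commute mult_pCons_left
          add.right_neutral mult_zero_left pCons_0_0)
    then show "r = 0" using GV_faithful[OF J] by (simp add: poly_eq_iff)
  next
    fix f assume f: "hom_on ?E f"
    have "hom_on (ideal_gen A) (\<lambda>a. poly.coeff (f [:a:]) i)" for i
      unfolding hom_on_def
    proof (intro conjI allI ballI)
      fix a b assume ab: "a \<in> ideal_gen A" "b \<in> ideal_gen A"
      then have "f ([:a:] + [:b:]) = f [:a:] + f [:b:]" using f const unfolding hom_on_def by blast
      then show "poly.coeff (f [:a + b:]) i = poly.coeff (f [:a:]) i + poly.coeff (f [:b:]) i" by simp
    next
      fix r a assume "a \<in> ideal_gen A"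
      then have "f ([:r:] * [:a:]) = [:r:] * f [:a:]" using f const unfolding hom_on_def by blast
      then show "poly.coeff (f [:r * a:]) i = r * poly.coeff (f [:a:]) i"
        by (simp add: mult.commute)
    qed
    then have "\<forall>i. \<exists>r. \<forall>a\<in>ideal_gen A. poly.coeff (f [:a:]) i = r * a" using GV_hom[OF J] by blast
    then obtain r where r: "\<And>i a. a \<in> ideal_gen A \<Longrightarrow> poly.coeff (f [:a:]) i = r i * a" by metis
    \<comment> \<open>Finitely many generators have images of bounded degree. Beyond the bound, r_i
      annihilates all generators and is 0 by faithfulness.\<close>
    obtain n where n: "\<And>a. a \<in> A \<Longrightarrow> Polynomial.degree (f [:a:]) \<le> n"
      using finite_imageI[OF A, of "\<lambda>a. Polynomial.degree (f [:a:])"]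
      by (auto simp: finite_nat_set_iff_bounded_le)
    have r0: "r i = 0" if "i > n" for i
    proof (rule GV_faithful[OF J])
      fix a assume a: "a \<in> ideal_gen A"
      have "b \<in> annih {r i}" if "b \<in> A" for b
      proof -
        have "Polynomial.degree (f [:b:]) < i" using n[OF that] \<open>i > n\<close> by simp
        then have "r i * b = 0" using r[OF ideal_gen_base[OF that], of i] by (simp add: coeff_eq_0)
        then show ?thesis by (simp add: annih_def mult.commute)
      qed
      then have "ideal_gen A \<subseteq> annih {r i}" by (intro ideal_gen_least is_ideal_annih) blast
      then show "r i * a = 0" using a by (auto simp: annih_def mult.commute)
    qed
    define p where "p = (\<Sum>i\<le>n. Polynomial.monom (r i) i)"
    have p: "poly.coeff p i = r i" for i
      using r0[of i] by (auto simp: p_def coeff_sum)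
    have "f a = p * a" if "a \<in> (\<lambda>a. [:a:]) ` A" for a
    proof -
      obtain b where b: "b \<in> A" "a = [:b:]" using \<open>a \<in> _\<close> by blast
      have "poly.coeff (f [:b:]) i = poly.coeff (p * [:b:]) i" for i
        using r[OF ideal_gen_base[OF b(1)], of i] by (simp add: p mult.commute)
      then show ?thesis by (simp add: b poly_eq_iff)
    qed
    from hom_on_gen_eq[OF f refl this]
    show "\<exists>r. \<forall>a\<in>?E. f a = r * a" by blast
  qed
qed

definition coeff_ideal :: "'a::comm_ring_1 poly set \<Rightarrow> 'a set" where
  "coeff_ideal Q = ideal_gen {poly.coeff q i |q i. q \<in> Q}"

lemma coeff_in_coeff_ideal: "q \<in> Q \<Longrightarrow> poly.coeff q i \<in> coeff_ideal Q"
  unfolding coeff_ideal_def by (rule ideal_gen_base) blast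

text \<open>The coefficients of a finite generating set suffice, because the polynomials with
  coefficients in a given ideal form an ideal of R[X].\<close>

lemma fin_gen_coeff_ideal:
  assumes "fin_gen_ideal Q"
  shows "fin_gen_ideal (coeff_ideal Q)"
proof -
  obtain S where S: "finite S" "Q = ideal_gen S" using assms by (auto simp: fin_gen_ideal_def)
  let ?A = "\<Union>q\<in>S. range (poly.coeff q)"
  have "range (poly.coeff q) \<subseteq> insert 0 (poly.coeff q ` {..Polynomial.degree q})" for q :: "'a poly"
    by (auto simp: coeff_eq_0 not_le) (metis atMost_iff coeff_eq_0 image_eqI not_le)
  then have "finite (range (poly.coeff q))" for q :: "'a poly"
    by (rule finite_subset) simp
  then have fin: "finite ?A" using S by blast
  have "S \<subseteq> poly_ideal (ideal_gen ?A)"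
    by (auto simp: poly_ideal_def intro!: ideal_gen_base)
  then have "Q \<subseteq> poly_ideal (ideal_gen ?A)"
    unfolding S(2) by (rule ideal_gen_least) (simp add: is_ideal_poly_ideal)
  then have "coeff_ideal Q \<subseteq> ideal_gen ?A"
    unfolding coeff_ideal_def by (intro ideal_gen_mono) (auto simp: poly_ideal_def)
  moreover have "ideal_gen ?A \<subseteq> coeff_ideal Q"
    unfolding coeff_ideal_def
    by (intro ideal_gen_mono subsetI ideal_gen_base) (auto simp: S(2) intro: ideal_gen_base)
  ultimately show ?thesis using fin unfolding fin_gen_ideal_def by blast
qed

text \<open>Applying f coefficientwise to members of Q gives an R[X]-linear map F, so F is
  multiplication by some p. It turns out that f is multiplication by the constant coefficient of
  p.\<close>

lemma coeff_ideal_in_GV: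
  assumes Q: "Q \<in> GV"
  shows "coeff_ideal Q \<in> GV"
  unfolding GV_iff
proof (intro conjI allI impI)
  show "fin_gen_ideal (coeff_ideal Q)" using Q by (simp add: fin_gen_coeff_ideal GV_fin_gen)
next
  fix r assume r: "\<forall>a\<in>coeff_ideal Q. r * a = 0"
  have "[:r:] * q = 0" if "q \<in> Q" for q
    using r coeff_in_coeff_ideal[OF that] by (simp add: poly_eq_iff)
  then have "[:r:] = 0" by (rule GV_faithful[OF Q])
  then show "r = 0" by simp
next
  fix f assume f: "hom_on (coeff_ideal Q) f"
  have I: "is_ideal (coeff_ideal Q)" by (simp add: coeff_ideal_def)
  have f0: "f 0 = 0" by (rule hom_on_zero[OF f I])
  note mem = coeff_in_coeff_ideal
  define F where "F = map_poly f"
  have F: "poly.coeff (F q) i = f (poly.coeff q i)" for q i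
    unfolding F_def by (rule coeff_map_poly[of f, OF f0])
  have "hom_on Q F"
    unfolding hom_on_def
  proof (intro conjI allI ballI)
    fix p q assume pq: "p \<in> Q" "q \<in> Q"
    have "f (poly.coeff p i + poly.coeff q i) = f (poly.coeff p i) + f (poly.coeff q i)" for i
      using f mem[OF pq(1)] mem[OF pq(2)] unfolding hom_on_def by blast
    then show "F (p + q) = F p + F q" by (simp add: poly_eq_iff F)
  next
    fix r q assume q: "q \<in> Q"
    have "f (poly.coeff (r * q) n) = poly.coeff (r * F q) n" for n
    proof -
      have "f (poly.coeff (r * q) n) = (\<Sum>i\<le>n. f (poly.coeff r i * poly.coeff q (n - i)))"
        unfolding coeff_mult using mem[OF q] by (intro hom_on_sum[OF f I] is_idealD(3)[OF I])
      also have "\<dots> = (\<Sum>i\<le>n. poly.coeff r i * f (poly.coeff q (n - i)))"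
        using f mem[OF q] by (intro sum.cong refl) (simp add: hom_on_def)
      finally show ?thesis by (simp add: coeff_mult F)
    qed
    then show "F (r * q) = r * F q" by (simp add: poly_eq_iff F)
  qed
  then obtain p where p: "\<forall>q\<in>Q. F q = p * q" using GV_hom[OF Q] by blast
  have "f a = poly.coeff p 0 * a" if a: "a \<in> coeff_ideal Q" for a
  proof -
    \<comment> \<open>Linearity gives f(a) q_i = a f(q_i) for every coefficient q_i of q, so f(a) q
      = a F(q) = a p q. Faithfulness of Q then yields f(a) = a p as polynomials.\<close>
    have "([:f a:] - [:a:] * p) * q = 0" if q: "q \<in> Q" for q
    proof -
      have "f a * poly.coeff q i = a * f (poly.coeff q i)" for i
      proof -
        have "f (poly.coeff q i * a) = poly.coeff q i * f a"
          "f (a * poly.coeff q i) = a * f (poly.coeff q i)"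
          using f a mem[OF q, of i] by (simp_all add: hom_on_def)
        then show ?thesis by (simp add: mult.commute)
      qed
      then have "[:f a:] * q = [:a:] * F q" by (simp add: poly_eq_iff F)
      also have "\<dots> = [:a:] * p * q" using p q by (simp only: mult.assoc)
      finally show ?thesis by (simp only: left_diff_distrib right_minus_eq)
    qed
    then have "[:f a:] - [:a:] * p = 0" by (rule GV_faithful[OF Q])
    then have "poly.coeff [:f a:] 0 = poly.coeff ([:a:] * p) 0" by (simp only: right_minus_eq)
    then show ?thesis by (simp add: mult.commute)
  qed
  then show "\<exists>r. \<forall>a\<in>coeff_ideal Q. f a = r * a" by blast
qed

section \<open>Ideals of the polynomial ring up to closure\<close>

text \<open>The degree is only bounded by m, so that zero and sums with cancelling leading terms
  need no separate treatment.\<close>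

definition lead_ideal :: "'a::comm_ring_1 poly set \<Rightarrow> nat \<Rightarrow> 'a set" where
  "lead_ideal A m = {poly.coeff f m |f. f \<in> A \<and> Polynomial.degree f \<le> m}"

lemma lead_idealI: "f \<in> A \<Longrightarrow> Polynomial.degree f \<le> m \<Longrightarrow> poly.coeff f m \<in> lead_ideal A m"
  by (auto simp: lead_ideal_def)

lemma is_ideal_lead_ideal:
  assumes A: "is_ideal A"
  shows "is_ideal (lead_ideal A m)"
proof (rule is_idealI)
  show "0 \<in> lead_ideal A m"
    using lead_idealI[OF is_idealD(1)[OF A], of m] by simp
next
  fix a b assume "a \<in> lead_ideal A m" "b \<in> lead_ideal A m"
  then obtain f g where "a = poly.coeff f m" "b = poly.coeff g m" "f \<in> A" "g \<in> A"
    "Polynomial.degree f \<le> m" "Polynomial.degree g \<le> m" by (auto simp: lead_ideal_def)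
  then show "a + b \<in> lead_ideal A m"
    using lead_idealI[OF is_idealD(2)[OF A], of f g m] by (simp add: Polynomial.degree_add_le)
next
  fix r a assume "a \<in> lead_ideal A m"
  then obtain f where f: "a = poly.coeff f m" "f \<in> A" "Polynomial.degree f \<le> m"
    by (auto simp: lead_ideal_def)
  then have "Polynomial.degree ([:r:] * f) \<le> m"
    by (simp add: order_trans[OF degree_smult_le])
  then show "r * a \<in> lead_ideal A m"
    using lead_idealI[OF is_idealD(3)[OF A f(2), of "[:r:]"], of m] f by simp
qed

lemma lead_ideal_le:
  assumes A: "is_ideal A" and "m \<le> n"
  shows "lead_ideal A m \<subseteq> lead_ideal A n"
proof
  fix a assume "a \<in> lead_ideal A m"
  then obtain f where f: "a = poly.coeff f m" "f \<in> A" "Polynomial.degree f \<le> m"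
    by (auto simp: lead_ideal_def)
  let ?g = "Polynomial.monom 1 (n - m) * f"
  have "Polynomial.degree ?g \<le> n"
    using degree_mult_le[of "Polynomial.monom 1 (n - m)" f] degree_monom_le[of "1::'a" "n - m"] f(3)
      assms(2) by linarith
  then have "poly.coeff ?g n \<in> lead_ideal A n"
    by (rule lead_idealI[OF is_idealD(3)[OF A f(2)]])
  then show "a \<in> lead_ideal A n" using assms(2) f(1)
    by (simp add: coeff_monom_mult split: if_splits)
qed

text \<open>The finitely many coefficients come from finitely many polynomials of P. The set B is
  quantified after S so that generators for other degrees can be added later.\<close>

lemma lead_ideal_finite_generators:
  assumes "finite A" "A \<subseteq> lead_ideal P m"
  shows "\<exists>S. finite S \<and> S \<subseteq> P \<and> (\<forall>B. S \<subseteq> B \<longrightarrow> A \<subseteq> lead_ideal B m)"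
proof -
  have "A \<subseteq> (\<lambda>f. poly.coeff f m) ` {f \<in> P. Polynomial.degree f \<le> m}"
    using assms(2) by (auto simp: lead_ideal_def)
  from finite_subset_image[OF assms(1) this]
  obtain S where S: "finite S" "S \<subseteq> {f \<in> P. Polynomial.degree f \<le> m}"
    "A = (\<lambda>f. poly.coeff f m) ` S" by blast
  have "A \<subseteq> lead_ideal B m" if "S \<subseteq> B" for B
    using S(2) that unfolding S(3) by (auto intro!: lead_idealI)
  then show ?thesis using S by blast
qed

context gv_system
begin

text \<open>The coefficient c of f at X^n satisfies cJ \<subseteq> \<open>lead_ideal B n\<close> for
  some J in G. For j in J, subtracting a suitable b in B from jf lowers the length, and induction
  supplies K in G moving the rest into B.\<close>

lemma subset_up_to_closure:
  assumes A: "is_ideal A" and B: "is_ideal B" "B \<subseteq> A"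
    and lead: "\<And>m. lead_ideal A m \<subseteq> ring_closure G (lead_ideal B m)"
    and f: "f \<in> A"
  shows "\<exists>J\<in>G. J \<subseteq> {j. [:j:] * f \<in> B}"
proof -
  have "\<exists>J\<in>G. J \<subseteq> {j. [:j:] * f \<in> B}" if "f \<in> A" "\<And>i. i \<ge> n \<Longrightarrow> poly.coeff f i = 0" for n f
    using that
  proof (induction n arbitrary: f)
    case 0
    then have "f = 0" by (simp add: poly_eq_iff)
    then show ?case using UNIV_mem is_idealD(1)[OF B(1)] by (intro bexI[of _ UNIV]) auto
  next
    case (Suc n)
    have "Polynomial.degree f \<le> n"
      using Suc.prems(2) by (intro degree_le) auto
    then have "poly.coeff f n \<in> ring_closure G (lead_ideal B n)"
      using lead lead_idealI Suc.prems(1) by blast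
    then obtain J where J: "J \<in> G" and Jsub: "\<And>j. j \<in> J \<Longrightarrow> poly.coeff f n * j \<in> lead_ideal B n"
      by (auto simp: ring_closure_def colon_def)
    have "\<exists>K\<in>G. K \<subseteq> {k. [:k:] * ([:j:] * f) \<in> B}" if j: "j \<in> J" for j
    proof -
      obtain b where b: "poly.coeff b n = poly.coeff f n * j" "b \<in> B" "Polynomial.degree b \<le> n"
        using Jsub[OF j] unfolding lead_ideal_def mem_Collect_eq by metis
      let ?h = "[:j:] * f - b"
      have "?h \<in> A" using b B(2) Suc.prems(1) by (intro is_ideal_diff[OF A] is_idealD(3)[OF A]) auto
      moreover have "poly.coeff ?h i = 0" if "i \<ge> n" for i
        using that Suc.prems(2)[of i] b coeff_eq_0[of b i]
        by (cases "i = n") (simp_all add: mult.commute)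
      ultimately obtain K where K: "K \<in> G" "K \<subseteq> {k. [:k:] * ?h \<in> B}" using Suc.IH by blast
      have "[:k:] * ([:j:] * f) \<in> B" if "k \<in> K" for k
      proof -
        have "[:k:] * ?h \<in> B" using K(2) that by blast
        then have "[:k:] * ?h + [:k:] * b \<in> B"
          by (rule is_idealD(2)[OF B(1) _ is_idealD(3)[OF B(1) b(2)]])
        moreover have "[:k:] * ?h + [:k:] * b = [:k:] * ([:j:] * f)"
          by (simp only: right_diff_distrib diff_add_cancel)
        ultimately show ?thesis by (simp only:)
      qed
      then show ?thesis using K(1) by blast
    qed
    \<comment> \<open>K depends on j, but a common L serves the finitely many generators of J; then
      JL moves f into B.\<close>
    moreover obtain S where S: "finite S" "J = ideal_gen S"
      using J subset_GV GV_fin_gen unfolding fin_gen_ideal_def by blast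
    ultimately obtain L where L: "L \<in> G" "\<forall>j\<in>S. L \<subseteq> {k. [:k:] * ([:j:] * f) \<in> B}"
      using common_lower_bound[OF S(1), of "\<lambda>j. {k. [:k:] * ([:j:] * f) \<in> B}"] ideal_gen_base
      by metis
    have swap: "[:j:] * ([:k:] * f) = [:k:] * ([:j:] * f)" for j k by (rule mult.left_commute)
    have "S \<subseteq> {j. [:j:] * ([:l:] * f) \<in> B}" if "l \<in> L" for l
      using L(2) that unfolding swap[of _ l] by blast
    then have JB: "J \<subseteq> {j. [:j:] * ([:l:] * f) \<in> B}" if "l \<in> L" for l
      unfolding S(2) using that by (intro ideal_gen_least is_ideal_constants B(1))
    have "ideal_prod J L \<subseteq> {k. [:k:] * f \<in> B}"
    proof (rule ideal_prod_least[OF is_ideal_constants[OF B(1)]])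
      fix j l assume "j \<in> J" "l \<in> L"
      then have "[:j:] * ([:l:] * f) \<in> B" using JB by blast
      then show "j * l \<in> {k. [:k:] * f \<in> B}" by (simp add: mult.commute)
    qed
    then show ?case using prod_mem[OF J L(1)] by blast
  qed
  then show ?thesis using f coeff_eq_0[of f] by (metis Suc_le_lessD)
qed

text \<open>As in Hilbert's basis theorem, T realises finitely many leading coefficients that
  generate, up to closure, the union of all leading ideals; they all occur at one degree d. This
  settles every degree from d on, and the sets \<open>S m\<close> settle the finitely many degrees m
  < d.\<close>

lemma finite_type_poly:
  assumes acc: "star_noetherian (closure_by G)" and A: "is_ideal (A :: 'a poly set)"
  shows "\<exists>S. finite S \<and> S \<subseteq> A \<and> (\<forall>f\<in>A. \<exists>J\<in>G. J \<subseteq> {j. [:j:] * f \<in> ideal_gen S})"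
proof -
  have "\<exists>S. finite S \<and> S \<subseteq> A \<and>
      (\<forall>B. is_ideal B \<longrightarrow> S \<subseteq> B \<longrightarrow> lead_ideal A m \<subseteq> ring_closure G (lead_ideal B m))" for m
  proof -
    obtain C where C: "finite C" "C \<subseteq> lead_ideal A m" "lead_ideal A m \<subseteq> ring_closure G (ideal_gen C)"
      using finite_type[OF acc is_ideal_lead_ideal[OF A]] by blast
    then obtain S where S: "finite S" "S \<subseteq> A" "\<And>B. S \<subseteq> B \<Longrightarrow> C \<subseteq> lead_ideal B m"
      using lead_ideal_finite_generators[OF C(1,2)] by blast
    have "lead_ideal A m \<subseteq> ring_closure G (lead_ideal B m)" if "is_ideal B" "S \<subseteq> B" for B
    proof -
      have "ideal_gen C \<subseteq> lead_ideal B m"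
        by (rule ideal_gen_least[OF S(3)[OF that(2)] is_ideal_lead_ideal[OF that(1)]])
      then show ?thesis using C(3) ring_closure_mono by blast
    qed
    then show ?thesis using S by blast
  qed
  then obtain S where S: "\<And>m. finite (S m)" "\<And>m. S m \<subseteq> A"
    "\<And>m B. is_ideal B \<Longrightarrow> S m \<subseteq> B \<Longrightarrow> lead_ideal A m \<subseteq> ring_closure G (lead_ideal B m)"
    by metis
  let ?L = "\<Union>m. lead_ideal A m"
  have lead_in: "x \<in> ?L" if "x \<in> lead_ideal A m" for x m using that by blast
  have "is_ideal ?L"
  proof (rule is_idealI)
    show "0 \<in> ?L" using is_idealD(1)[OF is_ideal_lead_ideal[OF A]] by blast
  next
    fix a b assume "a \<in> ?L" "b \<in> ?L"
    then obtain m n where "a \<in> lead_ideal A m" "b \<in> lead_ideal A n" by blast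
    then have "a \<in> lead_ideal A (max m n)" "b \<in> lead_ideal A (max m n)"
      using lead_ideal_le[OF A, of m "max m n"] lead_ideal_le[OF A, of n "max m n"] by auto
    then show "a + b \<in> ?L"
      using is_idealD(2)[OF is_ideal_lead_ideal[OF A]] by blast
  next
    fix r a assume "a \<in> ?L"
    then show "r * a \<in> ?L" using is_idealD(3)[OF is_ideal_lead_ideal[OF A]] by blast
  qed
  from finite_type[OF acc this]
  obtain C where C: "finite C" "C \<subseteq> ?L" "?L \<subseteq> ring_closure G (ideal_gen C)"
    by (elim exE conjE) (rule that)
  have "\<exists>d. C \<subseteq> lead_ideal A d"
    using C(1,2)
  proof (induction C rule: finite_induct)
    case (insert x C)
    then obtain m n where "x \<in> lead_ideal A m" "C \<subseteq> lead_ideal A n" by blast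
    then have "insert x C \<subseteq> lead_ideal A (max m n)"
      using lead_ideal_le[OF A, of m "max m n"] lead_ideal_le[OF A, of n "max m n"] by auto
    then show ?case by blast
  qed simp
  then obtain d where "C \<subseteq> lead_ideal A d" by blast
  from lead_ideal_finite_generators[OF C(1) this]
  obtain T where T: "finite T" "T \<subseteq> A" "\<forall>B. T \<subseteq> B \<longrightarrow> C \<subseteq> lead_ideal B d"
    by (elim exE conjE) (rule that)
  let ?S = "T \<union> (\<Union>m<d. S m)"
  let ?B = "ideal_gen ?S"
  have sub: "?S \<subseteq> A" using S(2) T(2) by blast
  have "lead_ideal A m \<subseteq> ring_closure G (lead_ideal ?B m)" for m
  proof (cases "m < d")
    case True
    then show ?thesis by (intro S(3)) (auto intro: ideal_gen_base)
  next
    case False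
    have "T \<subseteq> ?B" by (auto intro: ideal_gen_base)
    then have "C \<subseteq> lead_ideal ?B d" by (rule T(3)[rule_format])
    also have "\<dots> \<subseteq> lead_ideal ?B m" using False by (intro lead_ideal_le) simp_all
    finally have "ideal_gen C \<subseteq> lead_ideal ?B m"
      by (rule ideal_gen_least) (simp add: is_ideal_lead_ideal)
    then have "ring_closure G (ideal_gen C) \<subseteq> ring_closure G (lead_ideal ?B m)"
      by (rule ring_closure_mono)
    then show ?thesis using C(3) by blast
  qed
  then have "\<exists>J\<in>G. J \<subseteq> {j. [:j:] * f \<in> ?B}" if "f \<in> A" for f
    using subset_up_to_closure[OF A is_ideal_gen ideal_gen_least[OF sub A] _ that] by blast
  moreover have "finite ?S" using S(1) T(1) by simp
  ultimately show ?thesis using sub by blast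
qed

end

section \<open>Transfer of the chain condition between R and R[X]\<close>

text \<open>A finite S describing the union of the chain up to closure lies in some
  \<open>I n\<close>. If Jf \<subseteq> \<open>ideal_gen S\<close>, then the extension of J to R[X]
  is in \<open>GV\<close> and moves f into \<open>I n\<close>, which is closed.\<close>

lemma w_noetherian_poly:
  assumes "w_noetherian TYPE('a::comm_ring_1)"
  shows "w_noetherian TYPE('a poly)"
proof -
  have acc: "star_noetherian (closure_by (GV :: 'a set set))"
    using assms by (simp add: w_noetherian_def w_closure_eq)
  have "\<exists>n. \<forall>m\<ge>n. I m = I n"
    if closed: "\<And>n. closed_ideal GV (I n)" and step: "\<And>n. I n \<subseteq> I (Suc n)"
    for I :: "nat \<Rightarrow> 'a poly set"
  proof -
    have mono: "I m \<subseteq> I n" if "m \<le> n" for m n using that by (rule lift_Suc_mono_le[of I, OF step])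
    note ideal = is_idealD[OF closed_idealD(1)[OF closed]]
    have "is_ideal (\<Union>n. I n)"
    proof (rule is_idealI)
      show "0 \<in> (\<Union>n. I n)" using ideal(1) by blast
    next
      fix a b assume "a \<in> (\<Union>n. I n)" "b \<in> (\<Union>n. I n)"
      then obtain m n where "a \<in> I m" "b \<in> I n" by blast
      then have "a \<in> I (max m n)" "b \<in> I (max m n)"
        using mono[of m "max m n"] mono[of n "max m n"] by auto
      then show "a + b \<in> (\<Union>n. I n)" using ideal(2) by blast
    next
      fix r a assume "a \<in> (\<Union>n. I n)"
      then show "r * a \<in> (\<Union>n. I n)" using ideal(3) by blast
    qed
    from gv_system.finite_type_poly[OF gv_system_GV acc this]
    obtain S where S: "finite S" "S \<subseteq> (\<Union>n. I n)"
      "\<forall>f\<in>(\<Union>n. I n). \<exists>J\<in>GV. J \<subseteq> {j. [:j:] * f \<in> ideal_gen S}"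
      by (elim exE conjE) (rule that)
    have "\<exists>n. S \<subseteq> I n"
      using S(1,2)
    proof (induction S rule: finite_induct)
      case (insert x S)
      then obtain m n where "x \<in> I m" "S \<subseteq> I n" by blast
      then have "insert x S \<subseteq> I (max m n)"
        using mono[of m "max m n"] mono[of n "max m n"] by auto
      then show ?case by blast
    qed simp
    then obtain n where n: "ideal_gen S \<subseteq> I n"
      using ideal_gen_least closed_idealD(1)[OF closed] by metis
    have "f \<in> I n" if f: "f \<in> I m" for f m
    proof -
      obtain J where J: "J \<in> GV" "J \<subseteq> {j. [:j:] * f \<in> ideal_gen S}" using S(3) f by blast
      obtain A where A: "finite A" "J = ideal_gen A"
        using GV_fin_gen[OF J(1)] by (auto simp: fin_gen_ideal_def)
      have "(\<lambda>a. [:a:]) ` A \<subseteq> colon (I n) f"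
      proof (rule image_subsetI)
        fix a assume "a \<in> A"
        then have "[:a:] * f \<in> I n" using J(2) n ideal_gen_base[of a A] A(2) by blast
        then show "[:a:] \<in> colon (I n) f" by (simp only: colon_def mem_Collect_eq mult.commute)
      qed
      then have "ideal_gen ((\<lambda>a. [:a:]) ` A) \<subseteq> colon (I n) f"
        by (rule ideal_gen_least[OF _ is_ideal_colon[OF closed_idealD(1)[OF closed]]])
      then have "f \<in> ring_closure GV (I n)"
        using extension_in_GV[OF A(1)] J(1) A(2) unfolding ring_closure_def by blast
      then show ?thesis using closed unfolding closed_ideal_def by blast
    qed
    then have "\<forall>m\<ge>n. I m = I n" using mono by blast
    then show ?thesis by blast
  qed
  then show ?thesis
    by (simp add: w_noetherian_def w_closure_eq gv_system.star_noetherian_iff[OF gv_system_GV])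
qed

text \<open>The chain is extended to the closures of the ideals (I n)[X]. A constant a in such a
  closure has Qa \<subseteq> (I n)[X] with Q in \<open>GV\<close>, so the coefficient ideal of Q
  moves a into \<open>I n\<close>, and closedness gives a in \<open>I n\<close>.\<close>

lemma w_noetherian_of_poly:
  assumes "w_noetherian TYPE('a::comm_ring_1 poly)"
  shows "w_noetherian TYPE('a)"
proof -
  have acc: "star_noetherian (closure_by (GV :: 'a poly set set))"
    using assms by (simp add: w_noetherian_def w_closure_eq)
  have "\<exists>n. \<forall>m\<ge>n. I m = I n"
    if closed: "\<And>n. closed_ideal GV (I n)" and step: "\<And>n. I n \<subseteq> I (Suc n)"
    for I :: "nat \<Rightarrow> 'a set"
  proof -
    have mono: "I m \<subseteq> I n" if "m \<le> n" for m n using that by (rule lift_Suc_mono_le[of I, OF step])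
    let ?E = "\<lambda>n. ring_closure GV (poly_ideal (I n))"
    have PI: "is_ideal (poly_ideal (I n))" for n
      by (rule is_ideal_poly_ideal[OF closed_idealD(1)[OF closed]])
    have "closed_ideal GV (?E n)" for n
      by (rule gv_system.closed_ring_closure[OF gv_system_GV PI])
    moreover have "?E n \<subseteq> ?E (Suc n)" for n
      by (rule ring_closure_mono) (use step in \<open>auto simp: poly_ideal_def\<close>)
    ultimately obtain n where n: "\<forall>m\<ge>n. ?E m = ?E n"
      using acc[unfolded gv_system.star_noetherian_iff[OF gv_system_GV], rule_format, of ?E] by blast
    have "a \<in> I n" if "m \<ge> n" and a: "a \<in> I m" for a m
    proof -
      have "[:a:] \<in> poly_ideal (I m)"
        using monom_in_poly_ideal[OF closed_idealD(1)[OF closed] a, of 0] by (simp add: monom_0)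
      then have "[:a:] \<in> ?E m" using gv_system.ring_closure_superset[OF gv_system_GV PI] by blast
      then have "[:a:] \<in> ?E n" using n that(1) by blast
      then obtain Q where Q: "Q \<in> GV" "Q \<subseteq> colon (poly_ideal (I n)) [:a:]"
        by (auto simp: ring_closure_def)
      have "{poly.coeff q i |q i. q \<in> Q} \<subseteq> colon (I n) a"
        using Q(2) by (auto simp: colon_def poly_ideal_def)
      then have "coeff_ideal Q \<subseteq> colon (I n) a"
        unfolding coeff_ideal_def
        by (rule ideal_gen_least[OF _ is_ideal_colon[OF closed_idealD(1)[OF closed]]])
      then have "a \<in> ring_closure GV (I n)"
        using coeff_ideal_in_GV[OF Q(1)] by (auto simp: ring_closure_def)
      then show ?thesis using closed unfolding closed_ideal_def by blast
    qed
    then have "\<forall>m\<ge>n. I m = I n" using mono by blast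
    then show ?thesis by blast
  qed
  then show ?thesis
    by (simp add: w_noetherian_def w_closure_eq gv_system.star_noetherian_iff[OF gv_system_GV])
qed

section \<open>The localization of the polynomial ring\<close>

context gv_system
begin

lemma one_in_N_star: "1 \<in> N_star (closure_by G)"
proof -
  have "1 \<in> content_ideal (1 :: 'a poly)"
    using coeff_in_content_ideal[of "1 :: 'a poly" 0] by simp
  then have "x \<in> content_ideal 1" for x :: 'a
    using is_idealD(3)[OF is_ideal_content_ideal, of 1 1 x] by simp
  then show ?thesis unfolding N_star_iff using UNIV_mem by blast
qed

text \<open>Some J in G lies in the content of f. If all coefficients of f move a into I, then aJ
  \<subseteq> I and so a lies in I; this is the hypothesis of
  \<open>poly_ideal_cancel\<close>.\<close>

lemma closed_ideal_cancel:
  assumes I: "closed_ideal G I" and f: "f \<in> N_star (closure_by G)" and fg: "f * g \<in> poly_ideal I"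
  shows "g \<in> poly_ideal I"
proof -
  obtain J where J: "J \<in> G" "J \<subseteq> content_ideal f" using f by (auto simp: N_star_iff)
  have "a \<in> I" if a: "\<And>i. poly.coeff f i * a \<in> I" for a
  proof (rule closed_idealD(2)[OF I J(1)])
    fix j assume "j \<in> J"
    have "content_ideal f \<subseteq> colon I a"
      unfolding content_ideal_subset_iff[OF is_ideal_colon[OF closed_idealD(1)[OF I]]]
      using a by (simp add: poly_ideal_def colon_def mult.commute)
    then show "a * j \<in> I" using J(2) \<open>j \<in> J\<close> by (auto simp: colon_def)
  qed
  from poly_ideal_cancel[OF closed_idealD(1)[OF I] this fg] show ?thesis by blast
qed

text \<open>Cancelling f modulo the closure of the content of fg puts the content of g into that
  closure. Since the content of g contains a member of G, the closure contains 1.\<close>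

lemma mult_in_N_star:
  assumes f: "f \<in> N_star (closure_by G)" and g: "g \<in> N_star (closure_by G)"
  shows "f * g \<in> N_star (closure_by G)"
proof -
  let ?I = "ring_closure G (content_ideal (f * g))"
  have I: "closed_ideal G ?I" by (simp add: closed_ring_closure)
  have sub: "content_ideal (f * g) \<subseteq> ?I" by (simp add: ring_closure_superset)
  then have "f * g \<in> poly_ideal ?I"
    unfolding content_ideal_subset_iff[OF closed_idealD(1)[OF I]] .
  then have "g \<in> poly_ideal ?I" by (rule closed_ideal_cancel[OF I f])
  then have "content_ideal g \<subseteq> ?I"
    unfolding content_ideal_subset_iff[OF closed_idealD(1)[OF I]] .
  moreover obtain J where J: "J \<in> G" "J \<subseteq> content_ideal g" using g by (auto simp: N_star_iff)
  ultimately have "1 * j \<in> ?I" if "j \<in> J" for j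
    using that unfolding mult_1_left by blast
  then have "1 \<in> ?I" by (rule closed_idealD(2)[OF I J(1)])
  then show ?thesis by (simp add: N_star_iff ring_closure_def colon_def)
qed

lemmas N_star_loc = one_in_N_star mult_in_N_star

abbreviation S where "S \<equiv> N_star (closure_by G)"

abbreviation L where "L \<equiv> localization S"

lemma cring_L: "cring L"
  by (rule cring_localization[OF N_star_loc])

lemma zero_L: "\<zero>\<^bsub>L\<^esub> = loc_frac S 0 1"
  by (simp add: localization_def)

lemma loc_frac_zero: "s \<in> S \<Longrightarrow> loc_frac S 0 s = \<zero>\<^bsub>L\<^esub>"
  unfolding zero_L
  by (subst loc_frac_eq_iff[OF N_star_loc]) (auto intro: one_in_N_star)

lemma loc_frac_split:
  assumes "s \<in> S"
  shows "loc_frac S 1 s \<otimes>\<^bsub>L\<^esub> loc_frac S f 1 = loc_frac S f s"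
  using loc_mult[OF N_star_loc assms one_in_N_star, of 1 f] by simp

lemma loc_frac_numerator:
  assumes "s \<in> S"
  shows "loc_frac S s 1 \<otimes>\<^bsub>L\<^esub> loc_frac S f s = loc_frac S f 1"
proof -
  have "loc_frac S s 1 \<otimes>\<^bsub>L\<^esub> loc_frac S f s = loc_frac S (s * f) (1 * s)"
    by (rule loc_mult[OF N_star_loc one_in_N_star assms])
  also have "\<dots> = loc_frac S f 1"
    using assms by (subst loc_frac_eq_iff[OF N_star_loc])
      (auto simp: one_in_N_star mult.commute intro!: bexI[of _ 1])
  finally show ?thesis .
qed

lemma ideal_L_I:
  assumes sub: "I \<subseteq> carrier L" and zero: "\<zero>\<^bsub>L\<^esub> \<in> I"
    and add: "\<And>x y. x \<in> I \<Longrightarrow> y \<in> I \<Longrightarrow> x \<oplus>\<^bsub>L\<^esub> y \<in> I"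
    and mult: "\<And>r x. r \<in> carrier L \<Longrightarrow> x \<in> I \<Longrightarrow> r \<otimes>\<^bsub>L\<^esub> x \<in> I"
  shows "ideal I L"
proof -
  interpret cring L by (rule cring_L)
  have "\<ominus>\<^bsub>L\<^esub> x \<in> I" if "x \<in> I" for x
  proof -
    have "x \<in> carrier L" using that sub by blast
    then have "\<ominus>\<^bsub>L\<^esub> x = (\<ominus>\<^bsub>L\<^esub> \<one>\<^bsub>L\<^esub>) \<otimes>\<^bsub>L\<^esub> x" by (simp add: l_minus)
    also have "\<dots> \<in> I" using that by (intro mult) simp_all
    finally show ?thesis .
  qed
  then have "subgroup I (add_monoid L)"
    using sub zero add by unfold_locales (auto simp: a_inv_def)
  moreover have "x \<otimes>\<^bsub>L\<^esub> r \<in> I" if "x \<in> I" "r \<in> carrier L" for x r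
    using mult[OF that(2,1)] that sub m_comm[of x r] by auto
  ultimately show ?thesis using mult by (intro idealI ring_axioms)
qed

lemma is_ideal_numerators:
  assumes "ideal I L"
  shows "is_ideal {f. loc_frac S f 1 \<in> I}"
proof -
  interpret ideal I L by (rule assms)
  note one = one_in_N_star
  show ?thesis
  proof (rule is_idealI)
    show "0 \<in> {f. loc_frac S f 1 \<in> I}" using zero_closed by (simp add: loc_frac_zero one)
  next
    fix f g assume "f \<in> {f. loc_frac S f 1 \<in> I}" "g \<in> {f. loc_frac S f 1 \<in> I}"
    then have "loc_frac S f 1 \<oplus>\<^bsub>L\<^esub> loc_frac S g 1 \<in> I" by (simp add: a_closed)
    then show "f + g \<in> {f. loc_frac S f 1 \<in> I}"
      by (simp add: loc_add[OF N_star_loc one one])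
  next
    fix r f assume "f \<in> {f. loc_frac S f 1 \<in> I}"
    then have "loc_frac S r 1 \<otimes>\<^bsub>L\<^esub> loc_frac S f 1 \<in> I"
      using I_l_closed loc_frac_closed[OF N_star_loc one] by simp
    then show "r * f \<in> {f. loc_frac S f 1 \<in> I}"
      by (simp add: loc_mult[OF N_star_loc one one])
  qed
qed

text \<open>The contraction of I to R[X] is finitely generated up to closure, and passing to
  fractions removes the closure: a polynomial whose content is a member of G becomes a unit.\<close>

lemma noetherian_localization:
  assumes acc: "star_noetherian (closure_by G)"
  shows "noetherian_ring L"
proof -
  interpret cring L by (rule cring_L)
  show ?thesis
  proof (rule noetherian_ringI)
    fix I assume I: "ideal I L"
    let ?A = "{f. loc_frac S f 1 \<in> I}"
    from finite_type_poly[OF acc is_ideal_numerators[OF I]]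
    obtain T where T: "finite T" "T \<subseteq> ?A"
      and gen: "\<forall>f\<in>?A. \<exists>J\<in>G. J \<subseteq> {j. [:j:] * f \<in> ideal_gen T}"
      by (elim exE conjE) (rule that)
    let ?T = "(\<lambda>f. loc_frac S f 1) ` T"
    have Tc: "?T \<subseteq> carrier L" using loc_frac_closed[OF N_star_loc one_in_N_star] by blast
    have K: "ideal (Idl\<^bsub>L\<^esub> ?T) L" by (rule genideal_ideal[OF Tc])
    have "?T \<subseteq> Idl\<^bsub>L\<^esub> ?T" by (rule genideal_self[OF Tc])
    then have "T \<subseteq> {f. loc_frac S f 1 \<in> Idl\<^bsub>L\<^esub> ?T}" by blast
    then have gen_sub: "ideal_gen T \<subseteq> {f. loc_frac S f 1 \<in> Idl\<^bsub>L\<^esub> ?T}"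
      by (rule ideal_gen_least[OF _ is_ideal_numerators[OF K]])
    have "x \<in> Idl\<^bsub>L\<^esub> ?T" if x: "x \<in> I" for x
    proof -
      have "x \<in> carrier L" using x ideal.Icarr[OF I] by blast
      from loc_cases[OF N_star_loc this]
      obtain f s where s: "s \<in> S" and xfs: "x = loc_frac S f s" by blast
      have "loc_frac S f 1 \<in> I"
        using ideal.I_l_closed[OF I x loc_frac_closed[OF N_star_loc one_in_N_star], of s]
        by (simp add: xfs loc_frac_numerator[OF s])
      then obtain J where J: "J \<in> G" "J \<subseteq> {j. [:j:] * f \<in> ideal_gen T}" using gen by blast
      obtain A where A: "finite A" "J = ideal_gen A"
        using J subset_GV GV_fin_gen unfolding fin_gen_ideal_def by blast
      obtain xs where xs: "set xs = A" using finite_list[OF A(1)] by blast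
      \<comment> \<open>The generators of J are the coefficients of g, so its content contains J and
        g is a denominator. Each coefficient moves f into \<open>ideal_gen T\<close>, hence so does
        g, and x = gf / (gs).\<close>
      define g where "g = Poly xs"
      have "A \<subseteq> content_ideal g"
      proof
        fix a assume "a \<in> A"
        then obtain i where "i < length xs" "a = xs ! i" using xs by (metis in_set_conv_nth)
        then have "a = poly.coeff g i" by (simp add: g_def coeff_Poly_eq nth_default_def)
        then show "a \<in> content_ideal g" by (simp add: coeff_in_content_ideal)
      qed
      then have "J \<subseteq> content_ideal g" unfolding A(2) by (rule ideal_gen_least) simp
      then have gS: "g \<in> S" using J(1) by (auto simp: N_star_iff)
      have gA: "poly.coeff g i \<in> J" for i
        using xs is_idealD(1)[OF mem_is_ideal[OF J(1)]]
        by (auto simp: g_def coeff_Poly_eq nth_default_def A(2) intro!: ideal_gen_base)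
      have "Polynomial.monom (poly.coeff g i) i * f \<in> ideal_gen T" for i
      proof -
        have "[:poly.coeff g i:] * f \<in> ideal_gen T" using gA J(2) by blast
        then have "Polynomial.monom 1 i * ([:poly.coeff g i:] * f) \<in> ideal_gen T"
          by (rule is_idealD(3)[OF is_ideal_gen])
        then show ?thesis by (simp add: smult_monom flip: mult_smult_left)
      qed
      then have "(\<Sum>i\<le>Polynomial.degree g. Polynomial.monom (poly.coeff g i) i * f) \<in> ideal_gen T"
        by (intro is_ideal_sum is_ideal_gen)
      then have "g * f \<in> ideal_gen T"
        unfolding sum_distrib_right[symmetric] poly_as_sum_of_monoms .
      then have "loc_frac S (g * f) 1 \<in> Idl\<^bsub>L\<^esub> ?T" using gen_sub by blast
      moreover have gs: "g * s \<in> S" by (rule mult_in_N_star[OF gS s])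
      ultimately have "loc_frac S 1 (g * s) \<otimes>\<^bsub>L\<^esub> loc_frac S (g * f) 1 \<in> Idl\<^bsub>L\<^esub> ?T"
        by (intro ideal.I_l_closed[OF K] loc_frac_closed[OF N_star_loc])
      then have "loc_frac S (g * f) (g * s) \<in> Idl\<^bsub>L\<^esub> ?T"
        by (simp only: loc_frac_split[OF gs])
      moreover have "loc_frac S (g * f) (g * s) = x"
        unfolding xfs using gs s
        by (subst loc_frac_eq_iff[OF N_star_loc])
          (auto simp: one_in_N_star algebra_simps intro!: bexI[of _ 1])
      ultimately show ?thesis by simp
    qed
    moreover have "Idl\<^bsub>L\<^esub> ?T \<subseteq> I" by (rule genideal_minimal[OF I]) (use T(2) in blast)
    ultimately have "I = Idl\<^bsub>L\<^esub> ?T" by blast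
    then show "\<exists>A\<subseteq>carrier L. finite A \<and> I = Idl\<^bsub>L\<^esub> A" using T(1) Tc by blast
  qed
qed

text \<open>The ideals \<open>I n\<close> extend to ideals \<open>E n\<close> of the localization.
  Once the extensions stabilise, so do the \<open>I n\<close>, because denominators can be cancelled
  modulo (I n)[X].\<close>

lemma star_noetherian_of_localization:
  assumes noeth: "noetherian_ring L"
  shows "star_noetherian (closure_by G)"
  unfolding star_noetherian_iff
proof (intro allI impI)
  fix I :: "nat \<Rightarrow> 'a set"
  assume "(\<forall>n. closed_ideal G (I n)) \<and> (\<forall>n. I n \<subseteq> I (Suc n))"
  then have closed: "\<And>n. closed_ideal G (I n)" and step: "\<And>n. I n \<subseteq> I (Suc n)" by blast+
  have mono: "I m \<subseteq> I n" if "m \<le> n" for m n using that by (rule lift_Suc_mono_le[of I, OF step])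
  interpret cring L by (rule cring_L)
  note PI = is_ideal_poly_ideal[OF closed_idealD(1)[OF closed]]
  define E where "E n = {loc_frac S f s |f s. f \<in> poly_ideal (I n) \<and> s \<in> S}" for n
  have EI: "loc_frac S f s \<in> E n" if "f \<in> poly_ideal (I n)" "s \<in> S" for f s n
    using that by (auto simp: E_def)
  have "ideal (E n) L" for n
  proof (rule ideal_L_I)
    show "E n \<subseteq> carrier L" using loc_frac_closed[OF N_star_loc] by (auto simp: E_def)
    show "\<zero>\<^bsub>L\<^esub> \<in> E n" unfolding zero_L by (intro EI is_idealD(1)[OF PI] one_in_N_star)
  next
    fix x y assume "x \<in> E n" "y \<in> E n"
    then obtain f s g t where "x = loc_frac S f s" "y = loc_frac S g t"
      and fg: "f \<in> poly_ideal (I n)" "g \<in> poly_ideal (I n)" and st: "s \<in> S" "t \<in> S"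
      unfolding E_def by blast
    then have "x \<oplus>\<^bsub>L\<^esub> y = loc_frac S (f * t + g * s) (s * t)"
      by (simp add: loc_add[OF N_star_loc])
    also have "\<dots> \<in> E n"
      by (intro EI is_idealD(2)[OF PI] is_idealD(4)[OF PI] fg mult_in_N_star st)
    finally show "x \<oplus>\<^bsub>L\<^esub> y \<in> E n" .
  next
    fix r x assume "r \<in> carrier L" "x \<in> E n"
    then obtain f s where x: "x = loc_frac S f s" "f \<in> poly_ideal (I n)" "s \<in> S"
      unfolding E_def by blast
    from loc_cases[OF N_star_loc \<open>r \<in> carrier L\<close>]
    obtain g t where r: "t \<in> S" "r = loc_frac S g t" by blast
    have "r \<otimes>\<^bsub>L\<^esub> x = loc_frac S (g * f) (t * s)"
      using x r by (simp add: loc_mult[OF N_star_loc])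
    also have "\<dots> \<in> E n"
      by (intro EI is_idealD(3)[OF PI] mult_in_N_star x r)
    finally show "r \<otimes>\<^bsub>L\<^esub> x \<in> E n" .
  qed
  moreover have Emono: "E m \<subseteq> E n" if "m \<le> n" for m n
  proof -
    have "poly_ideal (I m) \<subseteq> poly_ideal (I n)" using mono[OF that] by (auto simp: poly_ideal_def)
    then show ?thesis unfolding E_def by blast
  qed
  then have "E m \<subseteq> E n \<or> E n \<subseteq> E m" for m n using linear[of m n] by blast
  ultimately have "subset.chain {I. ideal I L} (range E)"
    unfolding subset_chain_def by blast
  \<comment> \<open>The Noetherian property makes the union of the chain of extensions one of its
    members.\<close>
  then have "\<Union>(range E) \<in> range E"
    by (intro noetherian_ring.ideal_chain_is_trivial[OF noeth]) simp_all
  then obtain n where n: "\<And>m. E m \<subseteq> E n" by blast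
  have "a \<in> I n" if a: "a \<in> I m" for a m
  proof -
    have "[:a:] \<in> poly_ideal (I m)"
      using monom_in_poly_ideal[OF closed_idealD(1)[OF closed] a, of 0] by (simp add: monom_0)
    then have "loc_frac S [:a:] 1 \<in> E n" using EI[OF _ one_in_N_star] n by blast
    then obtain f s where fs: "loc_frac S [:a:] 1 = loc_frac S f s" "f \<in> poly_ideal (I n)" "s \<in> S"
      unfolding E_def by blast
    \<comment> \<open>Clearing denominators gives (vs)a = vf in (I n)[X] with vs in N, so vs can be
      cancelled.\<close>
    from iffD1[OF loc_frac_eq_iff[OF N_star_loc one_in_N_star fs(3)] fs(1)]
    obtain v where v: "v \<in> S" "v * ([:a:] * s - f * 1) = 0" by blast
    then have "(v * s) * [:a:] = v * f" by (simp add: algebra_simps)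
    also have "\<dots> \<in> poly_ideal (I n)" by (rule is_idealD(3)[OF PI fs(2)])
    finally have "[:a:] \<in> poly_ideal (I n)"
      by (rule closed_ideal_cancel[OF closed mult_in_N_star[OF v(1) fs(3)]])
    then have "poly.coeff [:a:] 0 \<in> I n" unfolding poly_ideal_def by blast
    then show ?thesis by simp
  qed
  then have "\<forall>m\<ge>n. I m = I n" using mono by blast
  then show "\<exists>n. \<forall>m\<ge>n. I m = I n" by blast
qed

lemma noetherian_localization_iff:
  "noetherian_ring (localization (N_star (closure_by G))) \<longleftrightarrow> star_noetherian (closure_by G)"
  using noetherian_localization star_noetherian_of_localization by blast

end

section \<open>The equivalences and u = w\<close>

theorem theorem7p9:
  shows "(u_noetherian TYPE('a::comm_ring_1) \<longleftrightarrow> w_noetherian TYPE('a)) \<and>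
    (w_noetherian TYPE('a) \<longleftrightarrow> u_noetherian TYPE('a poly)) \<and>
    (u_noetherian TYPE('a poly) \<longleftrightarrow> w_noetherian TYPE('a poly)) \<and>
    (w_noetherian TYPE('a poly) \<longleftrightarrow> noetherian_ring (localization (N_u :: 'a poly set))) \<and>
    (noetherian_ring (localization (N_u :: 'a poly set)) \<longleftrightarrow>
       noetherian_ring (localization (N_w :: 'a poly set))) \<and>
    (u_noetherian TYPE('a) \<longrightarrow>
       (\<forall>I :: 'a tq set. tq_submodule I \<longrightarrow> u_closure I = w_closure I))"
proof -
  have "w_noetherian TYPE('a) \<longleftrightarrow> w_noetherian TYPE('a poly)"
    using w_noetherian_poly w_noetherian_of_poly by blast
  moreover have "noetherian_ring (localization (N_u :: 'a poly set)) \<longleftrightarrow> u_noetherian TYPE('a)"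
    by (simp add: N_u_def u_noetherian_def u_closure_eq
        gv_system.noetherian_localization_iff[OF gv_system_rGV])
  moreover have "noetherian_ring (localization (N_w :: 'a poly set)) \<longleftrightarrow> w_noetherian TYPE('a)"
    by (simp add: N_w_def w_noetherian_def w_closure_eq
        gv_system.noetherian_localization_iff[OF gv_system_GV])
  moreover have "u_closure I = w_closure I" if "u_noetherian TYPE('a)" for I :: "'a tq set"
    using that by (simp add: u_closure_eq w_closure_eq rGV_eq_GV u_noetherian_iff_w_noetherian)
  ultimately show ?thesis
    using u_noetherian_iff_w_noetherian[where 'a = 'a]
      u_noetherian_iff_w_noetherian[where 'a = "'a poly"] by blast
qed

end
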